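(* Let $A=\langle\!\langle a,b,c\rangle\!\rangle$ be a $3$-generated primitive axial algebra of Monster type over a field of characteristic $0$, generated by axes $a,b,c$, where $\langle\!\langle a,b\rangle\!\rangle\cong 2\mathrm{L}$ and $\langle\!\langle a,c\rangle\!\rangle\cong2\mathrm{L}'$ with $\mathrm{L},\mathrm{L}'\in\{\mathrm{A},\mathrm{B}\}$, and $\langle\!\langle b,c\rangle\!\rangle$ is one of $3\mathrm{A}$, $3\mathrm{C}$, or $5\mathrm{A}$. Then: 1. $\mathrm{L}=\mathrm{L}'$. 2. If $\langle\!\langle a,b\rangle\!\rangle\cong\langle\!\langle a,c\rangle\!\rangle\cong2\mathrm{A}$, then $\langle\!\langle b,c\rangle\!\rangle\cong3\mathrm{A}$ and $A\cong6\mathrm{A}$. 3. If $\langle\!\langle a,b\rangle\!\rangle\cong\langle\!\langle a,c\rangle\!\rangle\cong2\mathrm{B}$, then $A\cong\langle\!\langle a\rangle\!\rangle\oplus\langle\!\langle b,c\rangle\!\rangle$.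
   Context: Let $\mathbb{F}$ be a field of characteristic $0$. A (primitive) axial algebra of Monster type is a pair $(A,X)$, where $A$ is a commutative, not necessarily associative $\mathbb{F}$-algebra generated by a set $X$ of non-zero idempotents (axes) such that for every $a\in X$: $\mathrm{ad}_a\colon v\mapsto av$ is semisimple with all eigenvalues in $\{1,0,\frac14,\frac1{32}\}$; $A_1(a)=\langle a\rangle$ is $1$-dimensional, where $A_\lambda(a)$ is the $\lambda$-eigenspace of $\mathrm{ad}_a$; and $A_\lambda(a)A_\mu(a)\subseteq\bigoplus_{\nu\in\lambda\star\mu}A_\nu(a)$, where $\star$ is the symmetric Monster fusion law $1\star1=\{1\}$, $1\star0=\emptyset$, $0\star0=\{0\}$, $1\star\frac14=0\star\frac14=\{\frac14\}$, $1\star\frac1{32}=0\star\frac1{32}=\frac14\star\frac1{32}=\{\frac1{32}\}$, $\frac14\star\frac14=\{1,0\}$, $\frac1{32}\star\frac1{32}=\{1,0,\frac14\}$. The Miyamoto involution $\tau_a$ is the automorphism of $A$ that is the identity on $A_1(a)\oplus A_0(a)\oplus A_{1/4}(a)$ and $-1$ on $A_{1/32}(a)$ (possibly trivial). $\langle\!\langle Y\rangle\!\rangle$ denotes the subalgebra generated by $Y$. Norton-Sakuma algebras (generated by axes $a_0,a_1$; all $a_i$ are idempotents; $\langle\!\langle p,q\rangle\!\rangle\cong n\mathrm{L}$ means there is an isomorphism sending $p,q$ to $a_0,a_1$, with $a_{\epsilon+2k}=a_\epsilon^{\rho^k}$, $\epsilon\in\{0,1\}$, $\rho=\tau_p\tau_q$):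 - $2\mathrm{A}$: basis $a_0,a_1,a_\rho$ of idempotents; the product of two distinct basis elements is $\frac18$(their sum minus the third basis element). - $2\mathrm{B}$: basis $a_0,a_1$; $a_0a_1=0$. - $3\mathrm{A}$: basis $a_{-1},a_0,a_1,u$ (indices mod $3$); $a_ia_{i+1}=\frac1{2^5}(2a_i+2a_{i+1}+a_{i-1})-\frac{3^3\cdot5}{2^{11}}u$, $a_iu=\frac19(2a_i-a_{i+1}-a_{i-1})+\frac5{2^5}u$, $u^2=u$. - $3\mathrm{C}$: basis $a_{-1},a_0,a_1$ (indices mod $3$); $a_ia_{i+1}=\frac1{2^6}(a_i+a_{i+1}-a_{i-1})$. - $5\mathrm{A}$: basis $a_{-2},\dots,a_2,w$ (indices mod $5$); $a_ia_{i+1}=\frac1{2^7}(3a_i+3a_{i+1}-a_{i+2}-a_{i-1}-a_{i-2})+w$, $a_ia_{i+2}=\frac1{2^7}(3a_i+3a_{i+2}-a_{i+1}-a_{i-1}-a_{i-2})-w$, $a_iw=\frac7{2^{12}}(a_{i+1}+a_{i-1}-a_{i+2}-a_{i-2})+\frac7{2^5}w$, $w^2=\frac{5^2\cdot7}{2^{19}}(a_{-2}+a_{-1}+a_0+a_1+a_2)$. - $6\mathrm{A}$: basis $a_{-2},\dots,a_3,a_{\rho^3},u$ (indices mod $6$); $a_ia_{i+1}=\frac1{2^6}(a_i+a_{i+1}-a_{i-2}-a_{i-1}-a_{i+2}-a_{i+3}+a_{\rho^3})+\frac{3^2\cdot5}{2^{11}}u$, $a_ia_{i+2}=\frac1{2^5}(2a_i+2a_{i+2}+a_{i-2})-\frac{3^3\cdot5}{2^{11}}u$,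 $a_ia_{i+3}=\frac18(a_i+a_{i+3}-a_{\rho^3})$, $a_ia_{\rho^3}=\frac18(a_i+a_{\rho^3}-a_{i+3})$, $a_iu=\frac19(2a_i-a_{i+2}-a_{i-2})+\frac5{2^5}u$, $a_{\rho^3}u=0$, $a_{\rho^3}^2=a_{\rho^3}$, $u^2=u$. In item 2, $A\cong6\mathrm{A}$ means isomorphic as algebras. *)

theory Defs
  imports "HOL-Analysis.Cartesian_Space"
begin

text \<open>The algebra is the whole type \<open>'v\<close>; its subalgebras are subsets of it.\<close>

locale comm_algebra = vector_space scale
  for scale :: "'f::field_char_0 \<Rightarrow> 'v::ab_group_add \<Rightarrow> 'v" +
  fixes mult :: "'v \<Rightarrow> 'v \<Rightarrow> 'v"
  assumes mult_commute: "mult x y = mult y x"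
    and mult_add_left: "mult (x + y) z = mult x z + mult y z"
    and mult_scale_left: "mult (scale r x) y = scale r (mult x y)"
begin

definition subalgebra :: "'v set \<Rightarrow> bool" where
  "subalgebra S \<longleftrightarrow> subspace S \<and> (\<forall>x\<in>S. \<forall>y\<in>S. mult x y \<in> S)"

definition generated_subalgebra :: "'v set \<Rightarrow> 'v set" where
  "generated_subalgebra Y = subalgebra hull Y"

definition eigenspace :: "'v \<Rightarrow> 'f \<Rightarrow> 'v set" where
  "eigenspace a \<alpha> = {v. mult a v = scale \<alpha> v}"

end

definition algebra_iso ::
  "('f \<Rightarrow> 'a::ab_group_add \<Rightarrow> 'a) \<Rightarrow> ('a \<Rightarrow> 'a \<Rightarrow> 'a) \<Rightarrow> 'a set \<Rightarrow>
   ('f \<Rightarrow> 'b::ab_group_add \<Rightarrow> 'b) \<Rightarrow> ('b \<Rightarrow> 'b \<Rightarrow> 'b) \<Rightarrow> 'b set \<Rightarrow>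
   ('a \<Rightarrow> 'b) \<Rightarrow> bool" where
  "algebra_iso s m S s' m' S' f \<longleftrightarrow>
     bij_betw f S S' \<and>
     (\<forall>x\<in>S. \<forall>y\<in>S. f (x + y) = f x + f y) \<and>
     (\<forall>r. \<forall>x\<in>S. f (s r x) = s' r (f x)) \<and>
     (\<forall>x\<in>S. \<forall>y\<in>S. f (m x y) = m' (f x) (f y))"

definition algebra_isomorphic ::
  "('f \<Rightarrow> 'a::ab_group_add \<Rightarrow> 'a) \<Rightarrow> ('a \<Rightarrow> 'a \<Rightarrow> 'a) \<Rightarrow> 'a set \<Rightarrow>
   ('f \<Rightarrow> 'b::ab_group_add \<Rightarrow> 'b) \<Rightarrow> ('b \<Rightarrow> 'b \<Rightarrow> 'b) \<Rightarrow> 'b set \<Rightarrow> bool" where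
  "algebra_isomorphic s m S s' m' S' \<longleftrightarrow> (\<exists>f. algebra_iso s m S s' m' S' f)"

text \<open>Operations of the external direct sum; its carrier is the Cartesian product of the summands,
  with the componentwise addition of the product type.\<close>

definition dsum_scale :: "('f \<Rightarrow> 'a \<Rightarrow> 'a) \<Rightarrow> 'f \<Rightarrow> 'a \<times> 'a \<Rightarrow> 'a \<times> 'a" where
  "dsum_scale s r x = (s r (fst x), s r (snd x))"

definition dsum_mult :: "('a \<Rightarrow> 'a \<Rightarrow> 'a) \<Rightarrow> 'a \<times> 'a \<Rightarrow> 'a \<times> 'a \<Rightarrow> 'a \<times> 'a" where
  "dsum_mult m x y = (m (fst x) (fst y), m (snd x) (snd y))"

definition monster_eigenvalues :: "'f::field_char_0 set" where
  "monster_eigenvalues = {1, 0, 1/4, 1/32}"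

text \<open>Only used for arguments in \<^const>\<open>monster_eigenvalues\<close>. The unordered pair
  \<open>{\<alpha>, \<beta>}\<close> makes the law symmetric.\<close>

definition monster_fusion :: "'f::field_char_0 \<Rightarrow> 'f \<Rightarrow> 'f set" where
  "monster_fusion \<alpha> \<beta> =
    (if {\<alpha>, \<beta>} = {1} then {1}
     else if {\<alpha>, \<beta>} = {1, 0} then {}
     else if {\<alpha>, \<beta>} = {0} then {0}
     else if {\<alpha>, \<beta>} = {1, 1/4} \<or> {\<alpha>, \<beta>} = {0, 1/4} then {1/4}
     else if {\<alpha>, \<beta>} = {1, 1/32} \<or> {\<alpha>, \<beta>} = {0, 1/32} \<or> {\<alpha>, \<beta>} = {1/4, 1/32} then {1/32}
     else if {\<alpha>, \<beta>} = {1/4} then {1, 0}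
     else if {\<alpha>, \<beta>} = {1/32} then {1, 0, 1/4}
     else {})"

context comm_algebra
begin

text \<open>Semisimple means diagonalisable: the eigenvectors span the algebra. Sums of eigenspaces
  for distinct eigenvalues are automatically direct, so spans of unions are direct sums.\<close>

definition monster_axis :: "'v \<Rightarrow> bool" where
  "monster_axis a \<longleftrightarrow>
     a \<noteq> 0 \<and> mult a a = a \<and>
     span (\<Union>\<alpha>. eigenspace a \<alpha>) = UNIV \<and>
     (\<forall>\<alpha>. eigenspace a \<alpha> \<noteq> {0} \<longrightarrow> \<alpha> \<in> monster_eigenvalues) \<and>
     eigenspace a 1 = span {a} \<and>
     (\<forall>\<alpha>\<in>monster_eigenvalues. \<forall>\<beta>\<in>monster_eigenvalues.
        \<forall>x\<in>eigenspace a \<alpha>. \<forall>y\<in>eigenspace a \<beta>.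
          mult x y \<in> span (\<Union>\<nu>\<in>monster_fusion \<alpha> \<beta>. eigenspace a \<nu>))"

definition miyamoto :: "'v \<Rightarrow> 'v \<Rightarrow> 'v" where
  "miyamoto a v =
     (THE w. \<exists>x \<in> span (eigenspace a 1 \<union> eigenspace a 0 \<union> eigenspace a (1/4)).
             \<exists>y \<in> eigenspace a (1/32). v = x + y \<and> w = x - y)"

end

locale monster_axial_algebra = comm_algebra scale mult
  for scale :: "'f::field_char_0 \<Rightarrow> 'v::ab_group_add \<Rightarrow> 'v" and mult :: "'v \<Rightarrow> 'v \<Rightarrow> 'v" +
  fixes X :: "'v set"
  assumes generated: "generated_subalgebra X = UNIV"
    and axes: "a \<in> X \<Longrightarrow> monster_axis a"

text \<open>The algebra with basis indexed by \<open>'n\<close> and structure constants \<open>T\<close> lives on \<open>'f ^ 'n\<close>.\<close>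

definition table_mult ::
  "('n \<Rightarrow> 'n \<Rightarrow> 'f ^ 'n) \<Rightarrow> 'f::field ^ 'n::finite \<Rightarrow> 'f ^ 'n \<Rightarrow> 'f ^ 'n" where
  "table_mult T x y = (\<Sum>i\<in>UNIV. \<Sum>j\<in>UNIV. (x $ i * y $ j) *s T i j)"

abbreviation basis_vec :: "'n::finite \<Rightarrow> 'f::field ^ 'n" where
  "basis_vec i \<equiv> axis i 1"

text \<open>The numeral types \<open>2\<close>, \<open>3\<close>, \<open>5\<close>, \<open>6\<close> are the integers modulo 2, 3, 5, 6, so \<open>i + 1\<close>,
  \<open>i - 1\<close> etc. are computed cyclically. In an option type, \<open>Some i\<close> indexes the axis \<open>a\<^sub>i\<close> and
  \<open>None\<close> the extra basis element (\<open>a\<^sub>\<rho>\<close> for 2A, \<open>u\<close> for 3A, \<open>w\<close> for 5A).\<close>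

fun table_2A :: "2 option \<Rightarrow> 2 option \<Rightarrow> 'f::field_char_0 ^ 2 option" where
  "table_2A (Some i) (Some j) =
     (if i = j then basis_vec (Some i)
      else (1/8) *s (basis_vec (Some i) + basis_vec (Some j) - basis_vec None))"
| "table_2A (Some i) None =
     (1/8) *s (basis_vec (Some i) + basis_vec None - basis_vec (Some (i + 1)))"
| "table_2A None (Some i) =
     (1/8) *s (basis_vec (Some i) + basis_vec None - basis_vec (Some (i + 1)))"
| "table_2A None None = basis_vec None"

definition table_2B :: "2 \<Rightarrow> 2 \<Rightarrow> 'f::field_char_0 ^ 2" where
  "table_2B i j = (if i = j then basis_vec i else 0)"

definition next_3A :: "3 \<Rightarrow> 'f::field_char_0 ^ 3 option" where
  "next_3A i =
     (1/2^5) *s (2 *s basis_vec (Some i) + 2 *s basis_vec (Some (i + 1)) + basis_vec (Some (i - 1)))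
     - (3^3 * 5 / 2^11) *s basis_vec None"

definition axis_u_3A :: "3 \<Rightarrow> 'f::field_char_0 ^ 3 option" where
  "axis_u_3A i =
     (1/9) *s (2 *s basis_vec (Some i) - basis_vec (Some (i + 1)) - basis_vec (Some (i - 1)))
     + (5/2^5) *s basis_vec None"

fun table_3A :: "3 option \<Rightarrow> 3 option \<Rightarrow> 'f::field_char_0 ^ 3 option" where
  "table_3A (Some i) (Some j) =
     (if j = i then basis_vec (Some i) else if j = i + 1 then next_3A i else next_3A j)"
| "table_3A (Some i) None = axis_u_3A i"
| "table_3A None (Some i) = axis_u_3A i"
| "table_3A None None = basis_vec None"

definition next_3C :: "3 \<Rightarrow> 'f::field_char_0 ^ 3" where
  "next_3C i = (1/2^6) *s (basis_vec i + basis_vec (i + 1) - basis_vec (i - 1))"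

definition table_3C :: "3 \<Rightarrow> 3 \<Rightarrow> 'f::field_char_0 ^ 3" where
  "table_3C i j =
     (if j = i then basis_vec i else if j = i + 1 then next_3C i else next_3C j)"

definition next_5A :: "5 \<Rightarrow> 'f::field_char_0 ^ 5 option" where
  "next_5A i =
     (1/2^7) *s (3 *s basis_vec (Some i) + 3 *s basis_vec (Some (i + 1))
                 - basis_vec (Some (i + 2)) - basis_vec (Some (i - 1)) - basis_vec (Some (i - 2)))
     + basis_vec None"

definition next2_5A :: "5 \<Rightarrow> 'f::field_char_0 ^ 5 option" where
  "next2_5A i =
     (1/2^7) *s (3 *s basis_vec (Some i) + 3 *s basis_vec (Some (i + 2))
                 - basis_vec (Some (i + 1)) - basis_vec (Some (i - 1)) - basis_vec (Some (i - 2)))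
     - basis_vec None"

definition axis_w_5A :: "5 \<Rightarrow> 'f::field_char_0 ^ 5 option" where
  "axis_w_5A i =
     (7/2^12) *s (basis_vec (Some (i + 1)) + basis_vec (Some (i - 1))
                  - basis_vec (Some (i + 2)) - basis_vec (Some (i - 2)))
     + (7/2^5) *s basis_vec None"

fun table_5A :: "5 option \<Rightarrow> 5 option \<Rightarrow> 'f::field_char_0 ^ 5 option" where
  "table_5A (Some i) (Some j) =
     (if j = i then basis_vec (Some i)
      else if j = i + 1 then next_5A i
      else if i = j + 1 then next_5A j
      else if j = i + 2 then next2_5A i
      else next2_5A j)"
| "table_5A (Some i) None = axis_w_5A i"
| "table_5A None (Some i) = axis_w_5A i"
| "table_5A None None = (5^2 * 7 / 2^19) *s (\<Sum>i\<in>UNIV. basis_vec (Some i))"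

text \<open>\<open>Axis6 i\<close>, \<open>Rho6\<close>, \<open>U6\<close> index \<open>a\<^sub>i\<close> (\<open>i\<close> modulo 6), the idempotent
  \<open>a_(\<rho>^3)\<close>, and \<open>u\<close>.\<close>

datatype basis_6A = Axis6 6 | Rho6 | U6

instance basis_6A :: finite
proof
  have "(UNIV :: basis_6A set) \<subseteq> range Axis6 \<union> {Rho6, U6}"
    using basis_6A.exhaust by blast
  then show "finite (UNIV :: basis_6A set)"
    by (rule finite_subset) simp
qed

definition next_6A :: "6 \<Rightarrow> 'f::field_char_0 ^ basis_6A" where
  "next_6A i =
     (1/2^6) *s (basis_vec (Axis6 i) + basis_vec (Axis6 (i + 1))
                 - basis_vec (Axis6 (i - 2)) - basis_vec (Axis6 (i - 1))
                 - basis_vec (Axis6 (i + 2)) - basis_vec (Axis6 (i + 3)) + basis_vec Rho6)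
     + (3^2 * 5 / 2^11) *s basis_vec U6"

definition next2_6A :: "6 \<Rightarrow> 'f::field_char_0 ^ basis_6A" where
  "next2_6A i =
     (1/2^5) *s (2 *s basis_vec (Axis6 i) + 2 *s basis_vec (Axis6 (i + 2)) + basis_vec (Axis6 (i - 2)))
     - (3^3 * 5 / 2^11) *s basis_vec U6"

definition next3_6A :: "6 \<Rightarrow> 'f::field_char_0 ^ basis_6A" where
  "next3_6A i =
     (1/8) *s (basis_vec (Axis6 i) + basis_vec (Axis6 (i + 3)) - basis_vec Rho6)"

definition axis_rho_6A :: "6 \<Rightarrow> 'f::field_char_0 ^ basis_6A" where
  "axis_rho_6A i =
     (1/8) *s (basis_vec (Axis6 i) + basis_vec Rho6 - basis_vec (Axis6 (i + 3)))"

definition axis_u_6A :: "6 \<Rightarrow> 'f::field_char_0 ^ basis_6A" where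
  "axis_u_6A i =
     (1/9) *s (2 *s basis_vec (Axis6 i) - basis_vec (Axis6 (i + 2)) - basis_vec (Axis6 (i - 2)))
     + (5/2^5) *s basis_vec U6"

fun table_6A :: "basis_6A \<Rightarrow> basis_6A \<Rightarrow> 'f::field_char_0 ^ basis_6A" where
  "table_6A (Axis6 i) (Axis6 j) =
     (if j = i then basis_vec (Axis6 i)
      else if j = i + 1 then next_6A i
      else if i = j + 1 then next_6A j
      else if j = i + 2 then next2_6A i
      else if i = j + 2 then next2_6A j
      else next3_6A i)"
| "table_6A (Axis6 i) Rho6 = axis_rho_6A i"
| "table_6A Rho6 (Axis6 i) = axis_rho_6A i"
| "table_6A (Axis6 i) U6 = axis_u_6A i"
| "table_6A U6 (Axis6 i) = axis_u_6A i"
| "table_6A Rho6 Rho6 = basis_vec Rho6"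
| "table_6A U6 U6 = basis_vec U6"
| "table_6A Rho6 U6 = 0"
| "table_6A U6 Rho6 = 0"

datatype dihedral_type = D2A | D2B | D3A | D3C | D5A

context comm_algebra
begin

text \<open>An isomorphism onto a model sends the images of \<open>p\<close> and \<open>q\<close> under the powers of
  \<open>\<rho> = \<tau>\<^sub>p \<tau>\<^sub>q\<close> to the axes \<open>a\<^sub>2\<^sub>k\<close> and \<open>a\<^sub>1\<^sub>+\<^sub>2\<^sub>k\<close>; \<open>k = 0\<close> says that \<open>p, q\<close> go to \<open>a\<^sub>0, a\<^sub>1\<close>.
  Involutions act on the right, so \<open>\<tau>\<^sub>p\<close> is applied first. The argument \<open>ax n\<close> is the basis
  index of \<open>a\<^sub>n\<close>.\<close>

definition dihedral_iso ::
  "('n::finite \<Rightarrow> 'n \<Rightarrow> 'f ^ 'n) \<Rightarrow> (nat \<Rightarrow> 'n) \<Rightarrow> 'v \<Rightarrow> 'v \<Rightarrow> bool" where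
  "dihedral_iso T ax p q \<longleftrightarrow>
     (\<exists>f. algebra_iso scale mult (generated_subalgebra {p, q}) (*s) (table_mult T) UNIV f \<and>
          (\<forall>k. let \<rho> = miyamoto q \<circ> miyamoto p in
               f ((\<rho> ^^ k) p) = basis_vec (ax (2 * k)) \<and>
               f ((\<rho> ^^ k) q) = basis_vec (ax (1 + 2 * k))))"

primrec has_type :: "'v \<Rightarrow> 'v \<Rightarrow> dihedral_type \<Rightarrow> bool" where
  "has_type p q D2A = dihedral_iso table_2A (\<lambda>n. Some (of_nat n)) p q"
| "has_type p q D2B = dihedral_iso table_2B of_nat p q"
| "has_type p q D3A = dihedral_iso table_3A (\<lambda>n. Some (of_nat n)) p q"
| "has_type p q D3C = dihedral_iso table_3C of_nat p q"
| "has_type p q D5A = dihedral_iso table_5A (\<lambda>n. Some (of_nat n)) p q"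

text \<open>Only an isomorphism of algebras: no generators are prescribed.\<close>

definition iso_6A :: "bool" where
  "iso_6A \<longleftrightarrow> algebra_isomorphic scale mult UNIV
     (*s) (table_mult (table_6A :: basis_6A \<Rightarrow> basis_6A \<Rightarrow> 'f ^ basis_6A)) UNIV"

end

end

theory Submission imports Defs begin

text \<open>Let \<open>A\<close> be generated by the axes \<open>a\<close>, \<open>b\<close>, \<open>c\<close> as in the theorem. In a 2A or 2B algebra the two
generating axes are fixed by each other's Miyamoto involution. Hence \<open>\<tau>\<^sub>a\<close> fixes all generators and is
trivial, that is, \<open>1/32\<close> is not an eigenvalue of \<open>a\<close>, while \<open>\<tau>\<^sub>b\<close> and \<open>\<tau>\<^sub>c\<close> fix \<open>a\<close>. Since 3A, 3C and 5A are
of odd type, a power of \<open>\<rho> = \<tau>\<^sub>b \<tau>\<^sub>c\<close> moves \<open>b\<close> to \<open>c\<close>. It fixes \<open>a\<close>, so \<open>a b = 0\<close> exactly if \<open>a c = 0\<close>, and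
therefore the two types 2A, 2B agree (\<open>two_generated_fixed\<close>, \<open>odd_dihedral_conjugate\<close>). If both are 2B, then \<open>b\<close>
and \<open>c\<close> lie in the \<open>0\<close>-eigenspace of \<open>a\<close>, which is a subalgebra, and \<open>A\<close> is a direct sum
(\<open>annihilated_generators_direct_sum\<close>).

Let both be 2A. Every axis \<open>x\<^sub>i\<close> in the orbit of \<open>b\<close> then has the form \<open>x\<^sub>i = a/8 + Z\<^sub>i + Y\<^sub>i\<close> with \<open>a Z\<^sub>i = 0\<close> and
\<open>a Y\<^sub>i = Y\<^sub>i/4\<close>. The eigenvalue \<open>1/4\<close> of \<open>a\<close> defines a parity, so every equation in \<open>A\<close> splits into two. The
reflections of the orbit yield \<open>1/32\<close>-eigenvectors of \<open>x\<^sub>i\<close>; because the orbit is odd, they imply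
\<open>Z\<^sub>i Y\<^sub>j = Z\<^sub>j Y\<^sub>i\<close> (\<open>Z_times_Y_commute\<close>). Next, an eigenvector of \<open>x\<^sub>0\<close> in the algebra of \<open>b\<close> and \<open>c\<close> is multiplied by
the eigenvectors of \<open>x\<^sub>0\<close> in the algebra of \<open>a\<close> and \<open>b\<close>, and the fusion law of \<open>x\<^sub>0\<close> is applied
(\<open>zero_eigenvector_products\<close>, \<open>quarter_eigenvector_products\<close>).

In 3C and 5A there is a \<open>0\<close>-eigenvector of \<open>x\<^sub>0\<close> that is a combination of the \<open>x\<^sub>i\<close> alone. It forces all \<open>Y\<^sub>i\<close>, and then
all \<open>x\<^sub>i\<close>, to be equal, which is absurd (\<open>orbit_collapses\<close>). In 3A the \<open>0\<close>-eigenvector and the \<open>1/4\<close>-eigenvector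
both involve \<open>u\<close>. Their difference does not, and this resurrection trick expresses the products of \<open>x\<^sub>0\<close> with the
components of \<open>u\<close> by known ones. Comparing coefficients then shows \<open>a u = 0\<close> and determines
\<open>Y\<^sub>i Y\<^sub>j\<close> (\<open>u_annihilated\<close>). Now \<open>a\<close>, \<open>u\<close>, the \<open>x\<^sub>i\<close> and their mirror images \<open>a/8 + Z\<^sub>i - Y\<^sub>i\<close> multiply as the basis
of 6A. They span \<open>A\<close> because it is generated by three of them, and they are independent because already \<open>a \<noteq> 0\<close>
makes the \<open>Y\<^sub>i\<close> independent (\<open>is_6A\<close>).\<close>

section \<open>Linear identities and bilinearity\<close>

context comm_algebra
begin

text \<open>Linear functionals separate points. This turns an identity between explicit linear combinations of
  vectors into an identity of field elements, which ring normalisation decides.\<close>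

lemma eq_by_functionals:
  assumes "\<And>\<phi>. Vector_Spaces.linear scale (*) \<phi> \<Longrightarrow> \<phi> v = \<phi> w"
  shows "v = w"
proof (rule ccontr)
  assume "v \<noteq> w"
  interpret field: vector_space "(*) :: 'f \<Rightarrow> 'f \<Rightarrow> 'f"
    by unfold_locales (simp_all add: algebra_simps)
  interpret to_field: vector_space_pair scale "(*) :: 'f \<Rightarrow> 'f \<Rightarrow> 'f" ..
  have "independent {v - w}" using \<open>v \<noteq> w\<close> by (simp add: dependent_single)
  from to_field.linear_independent_extend[OF this, of "\<lambda>_. 1"]
  obtain \<phi> where \<phi>: "Vector_Spaces.linear scale (*) \<phi>" "\<phi> (v - w) = 1" by auto
  interpret \<phi>: Vector_Spaces.linear scale "(*)" \<phi> by (rule \<phi>)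
  have "\<phi> v - \<phi> w = 1" using \<phi>(2) by (simp add: \<phi>.diff)
  then show False using assms[OF \<phi>(1)] by simp
qed

lemma functional_simps:
  assumes "Vector_Spaces.linear scale (*) \<phi>"
  shows "\<phi> (x + y) = \<phi> x + \<phi> y" "\<phi> (x - y) = \<phi> x - \<phi> y" "\<phi> (- x) = - \<phi> x"
    "\<phi> 0 = 0" "\<phi> (scale r x) = r * \<phi> x"
proof -
  interpret \<phi>: Vector_Spaces.linear scale "(*)" \<phi> by (rule assms)
  show "\<phi> (x + y) = \<phi> x + \<phi> y" "\<phi> (x - y) = \<phi> x - \<phi> y" "\<phi> (- x) = - \<phi> x"
    "\<phi> 0 = 0" "\<phi> (scale r x) = r * \<phi> x"
    by (simp_all add: \<phi>.add \<phi>.diff \<phi>.neg \<phi>.zero \<phi>.scale)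
qed

text \<open>To deduce an equation from known ones, \<open>v - w\<close> is written as a combination of their defects. What
  remains is an unconditional identity, to which \<open>eq_by_functionals\<close> applies.\<close>

lemma eq_by_combination: "l = r \<Longrightarrow> v - w = scale c (l - r) \<Longrightarrow> v = w"
  by simp

lemma eq_by_combination2:
  "l = r \<Longrightarrow> l' = r' \<Longrightarrow> v - w = scale c (l - r) + scale c' (l' - r') \<Longrightarrow> v = w"
  by simp

lemma eq_by_combination3:
  "l = r \<Longrightarrow> l' = r' \<Longrightarrow> l'' = r'' \<Longrightarrow>
   v - w = scale c (l - r) + scale c' (l' - r') + scale c'' (l'' - r'') \<Longrightarrow> v = w"
  by simp

lemma mult_add_right: "mult x (y + z) = mult x y + mult x z"
  using mult_add_left mult_commute by metis

lemma mult_scale_right: "mult x (scale r y) = scale r (mult x y)"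
  using mult_scale_left mult_commute by metis

lemma mult_zero_left [simp]: "mult 0 x = 0"
  using mult_scale_left[of 0 0 x] by simp

lemma mult_zero_right [simp]: "mult x 0 = 0"
  using mult_zero_left mult_commute by metis

lemma mult_minus_left: "mult (- x) y = - mult x y"
  using mult_scale_left[of "-1" x y] by simp

lemma mult_minus_right: "mult x (- y) = - mult x y"
  using mult_minus_left mult_commute by metis

lemma mult_diff_left: "mult (x - y) z = mult x z - mult y z"
  using mult_add_left[of x "- y" z] mult_minus_left by simp

lemma mult_diff_right: "mult x (y - z) = mult x y - mult x z"
  using mult_diff_left mult_commute by metis

lemmas mult_linear = mult_add_left mult_add_right mult_diff_left mult_diff_right
  mult_minus_left mult_minus_right mult_scale_left mult_scale_right mult_zero_left mult_zero_right

lemma mult_sum_right: "mult v (sum f A) = (\<Sum>j\<in>A. mult v (f j))"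
  by (induction A rule: infinite_finite_induct) (simp_all add: mult_add_right)

section \<open>Axes and their Miyamoto involutions\<close>

lemma subspace_eigenspace: "subspace (eigenspace p \<alpha>)"
  unfolding subspace_def eigenspace_def
  by (auto simp: mult_linear scale_right_distrib mult.commute)

lemma eigenspace_iff: "v \<in> eigenspace p \<alpha> \<longleftrightarrow> mult p v = scale \<alpha> v"
  by (simp add: eigenspace_def)

lemma eigenspace_linear:
  "v \<in> eigenspace p \<alpha> \<Longrightarrow> w \<in> eigenspace p \<alpha> \<Longrightarrow> v + w \<in> eigenspace p \<alpha>"
  "v \<in> eigenspace p \<alpha> \<Longrightarrow> scale r v \<in> eigenspace p \<alpha>"
  "0 \<in> eigenspace p \<alpha>"
  using subspace_eigenspace by (auto intro: subspace_add subspace_scale subspace_0)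

text \<open>The even part of the grading by the group of order two that the fusion law admits; the
  \<open>1/32\<close>-eigenspace is the odd part.\<close>

definition even_part :: "'v \<Rightarrow> 'v set" where
  "even_part p = span (eigenspace p 1 \<union> eigenspace p 0 \<union> eigenspace p (1/4))"

lemma subspace_even_part: "subspace (even_part p)"
  by (simp add: even_part_def)

lemma eigenspace_even_part:
  "eigenspace p 1 \<subseteq> even_part p" "eigenspace p 0 \<subseteq> even_part p" "eigenspace p (1/4) \<subseteq> even_part p"
  unfolding even_part_def by (auto intro: span_base)

lemma even_part_decomposition:
  assumes "monster_axis p" "v \<in> even_part p"
  obtains r v0 v4 where "v = scale r p + v0 + v4" "v0 \<in> eigenspace p 0" "v4 \<in> eigenspace p (1/4)"
proof -
  let ?S = "{w + v4 |w v4. w \<in> {x + v0 |x v0. x \<in> eigenspace p 1 \<and> v0 \<in> eigenspace p 0}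
      \<and> v4 \<in> eigenspace p (1/4)}"
  have sub: "subspace ?S"
    by (intro subspace_sums subspace_eigenspace)
  have "eigenspace p 1 \<union> eigenspace p 0 \<union> eigenspace p (1/4) \<subseteq> ?S"
  proof
    fix x assume "x \<in> eigenspace p 1 \<union> eigenspace p 0 \<union> eigenspace p (1/4)"
    then consider "x \<in> eigenspace p 1" | "x \<in> eigenspace p 0" | "x \<in> eigenspace p (1/4)" by blast
    then show "x \<in> ?S"
    proof cases
      case 1
      have "x = (x + 0) + 0" by simp
      with 1 eigenspace_linear(3) show ?thesis by blast
    next
      case 2
      have "x = (0 + x) + 0" by simp
      with 2 eigenspace_linear(3) show ?thesis by blast
    next
      case 3
      have "x = (0 + 0) + x" by simp
      with 3 eigenspace_linear(3) show ?thesis by blast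
    qed
  qed
  then have "even_part p \<subseteq> ?S" unfolding even_part_def by (rule span_minimal[OF _ sub])
  with assms(2) obtain x v0 v4 where *: "v = x + v0 + v4" "x \<in> eigenspace p 1"
    "v0 \<in> eigenspace p 0" "v4 \<in> eigenspace p (1/4)" by blast
  from *(2) assms(1) have "x \<in> span {p}" by (simp add: monster_axis_def)
  then obtain r where "x = scale r p" by (auto simp: span_singleton)
  with * that show ?thesis by blast
qed

lemma axis_in_even_part: "monster_axis p \<Longrightarrow> p \<in> even_part p"
proof -
  assume "monster_axis p"
  then have "p \<in> eigenspace p 1" by (simp add: monster_axis_def span_base)
  then show ?thesis using eigenspace_even_part by blast
qed

lemma grading_decomposition:
  assumes "monster_axis p"
  obtains x y where "v = x + y" "x \<in> even_part p" "y \<in> eigenspace p (1/32)"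
proof -
  let ?S = "{x + y |x y. x \<in> even_part p \<and> y \<in> eigenspace p (1/32)}"
  have sub: "subspace ?S"
    by (intro subspace_sums subspace_eigenspace subspace_even_part)
  have "(\<Union>\<alpha>. eigenspace p \<alpha>) \<subseteq> ?S"
  proof
    fix x assume "x \<in> (\<Union>\<alpha>. eigenspace p \<alpha>)"
    then obtain \<alpha> where x: "x \<in> eigenspace p \<alpha>" by blast
    show "x \<in> ?S"
    proof (cases "x = 0")
      case True
      then show ?thesis using subspace_0[OF sub] by simp
    next
      case False
      with x assms have "\<alpha> \<in> monster_eigenvalues" by (auto simp: monster_axis_def)
      then consider "x \<in> even_part p" | "x \<in> eigenspace p (1/32)"
        using x eigenspace_even_part[THEN subsetD] unfolding monster_eigenvalues_def by blast
      then show ?thesis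
      proof cases
        case 1
        have "x = x + 0" by simp
        with 1 eigenspace_linear(3) show ?thesis by blast
      next
        case 2
        have "x = 0 + x" by simp
        with 2 subspace_0[OF subspace_even_part] show ?thesis by blast
      qed
    qed
  qed
  then have "span (\<Union>\<alpha>. eigenspace p \<alpha>) \<subseteq> ?S" by (rule span_minimal[OF _ sub])
  with assms have "v \<in> ?S" by (auto simp: monster_axis_def)
  with that show ?thesis by blast
qed

text \<open>For an even vector \<open>v\<close>, the polynomial \<open>t (t - 1) (t - 1/4)\<close> in the adjoint of \<open>p\<close> kills \<open>v\<close>,
  whereas it acts on the \<open>1/32\<close>-eigenspace as the scalar \<open>217/32768\<close>. Writing the odd component as a
  polynomial in the adjoint shows at once that it is unique and that it stays in every subalgebra
  containing \<open>p\<close> and the vector.\<close>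

definition odd_projection :: "'v \<Rightarrow> 'v \<Rightarrow> 'v" where
  "odd_projection p v = (let v1 = mult p v; v2 = mult p v1 - v1; v3 = mult p v2 - scale (1/4) v2
     in scale (32768/217) v3)"

lemma odd_projection:
  assumes p: "monster_axis p" and x: "x \<in> even_part p" and y: "y \<in> eigenspace p (1/32)"
  shows "odd_projection p (x + y) = y"
proof -
  obtain r v0 v4 where v: "x = scale r p + v0 + v4" "mult p v0 = 0" "mult p v4 = scale (1/4) v4"
    by (rule even_part_decomposition[OF p x]) (simp add: eigenspace_iff)
  have y': "mult p y = scale (1/32) y" using y by (simp add: eigenspace_iff)
  have pp: "mult p p = p" using p by (simp add: monster_axis_def)
  show ?thesis
    unfolding odd_projection_def Let_def v(1)
    by (rule eq_by_functionals) (simp add: mult_linear v y' pp functional_simps field_simps)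
qed

lemma miyamoto_eq:
  assumes p: "monster_axis p" and x: "x \<in> even_part p" and y: "y \<in> eigenspace p (1/32)"
  shows "miyamoto p (x + y) = x - y"
  unfolding miyamoto_def even_part_def[symmetric]
proof (rule the_equality)
  show "\<exists>x'\<in>even_part p. \<exists>y'\<in>eigenspace p (1/32). x + y = x' + y' \<and> x - y = x' - y'"
    using x y by blast
next
  fix w assume "\<exists>x'\<in>even_part p. \<exists>y'\<in>eigenspace p (1/32). x + y = x' + y' \<and> w = x' - y'"
  then obtain x' y' where *: "x' \<in> even_part p" "y' \<in> eigenspace p (1/32)" "x + y = x' + y'" "w = x' - y'"
    by blast
  have "y = y'" using odd_projection[OF p x y] odd_projection[OF p *(1,2)] *(3) by simp
  then show "w = x - y" using * by simp
qed

lemma miyamoto_alt: "monster_axis p \<Longrightarrow> miyamoto p v = v - scale 2 (odd_projection p v)"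
proof -
  assume p: "monster_axis p"
  obtain x y where v: "v = x + y" "x \<in> even_part p" "y \<in> eigenspace p (1/32)"
    by (rule grading_decomposition[OF p])
  have "scale 2 y = y + y" using scale_left_distrib[of 1 1 y] by simp
  then show ?thesis using v miyamoto_eq[OF p v(2,3)] odd_projection[OF p v(2,3)] by simp
qed

lemma miyamoto_in_subalgebra:
  assumes "monster_axis p" "subalgebra U" "p \<in> U" "v \<in> U"
  shows "miyamoto p v \<in> U"
proof -
  have "subspace U" and closed: "\<And>x y. x \<in> U \<Longrightarrow> y \<in> U \<Longrightarrow> mult x y \<in> U"
    using assms(2) by (auto simp: subalgebra_def)
  then show ?thesis
    unfolding miyamoto_alt[OF assms(1)] odd_projection_def Let_def
    by (intro subspace_diff subspace_scale closed assms(3,4))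
qed

lemma miyamoto_negates_iff:
  assumes p: "monster_axis p"
  shows "miyamoto p v = - v \<longleftrightarrow> v \<in> eigenspace p (1/32)"
proof
  obtain x y where v: "v = x + y" "x \<in> even_part p" "y \<in> eigenspace p (1/32)"
    by (rule grading_decomposition[OF p])
  assume "miyamoto p v = - v"
  then have "x - y = - (x + y)" using v miyamoto_eq[OF p v(2,3)] by simp
  then have "x = - x" by (simp add: algebra_simps)
  then have "x + x = 0" by (metis add.right_inverse)
  then have "scale 2 x = 0" using scale_left_distrib[of 1 1 x] by simp
  then have "x = 0" by simp
  then show "v \<in> eigenspace p (1/32)" using v by simp
next
  assume "v \<in> eigenspace p (1/32)"
  then show "miyamoto p v = - v"
    using miyamoto_eq[OF p subspace_0[OF subspace_even_part]] by fastforce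
qed

lemma miyamoto_fixes_even_part:
  assumes "monster_axis p" "v \<in> even_part p"
  shows "miyamoto p v = v"
  using miyamoto_eq[OF assms eigenspace_linear(3)] by simp

text \<open>In characteristic 0 a vector that is both fixed and negated is zero.\<close>

lemma no_odd_part_if_trivial_miyamoto:
  assumes "monster_axis p" "\<And>v. miyamoto p v = v"
  shows "v \<in> even_part p"
proof -
  obtain x y where v: "v = x + y" "x \<in> even_part p" "y \<in> eigenspace p (1/32)"
    by (rule grading_decomposition[OF assms(1)])
  have "y = - y" using miyamoto_negates_iff[OF assms(1), of y] v(3) assms(2) by simp
  then have "y + y = 0" by (metis add.right_inverse)
  then have "scale 2 y = 0" using scale_left_distrib[of 1 1 y] by simp
  then show ?thesis using v by simp
qed

lemma monster_fusion_simps: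
  "monster_fusion 0 0 = ({0} :: 'f set)"
  "monster_fusion 0 (1/4) = ({1/4} :: 'f set)"
  "monster_fusion 0 (1/32) = ({1/32} :: 'f set)"
  "monster_fusion (1/4) (1/32) = ({1/32} :: 'f set)"
  "monster_fusion (1/4) (1/4) = ({1, 0} :: 'f set)"
  "monster_fusion (1/32) (1/32) = ({1, 0, 1/4} :: 'f set)"
  unfolding monster_fusion_def by (auto simp: doubleton_eq_iff)

lemma fusion:
  assumes "monster_axis p" "x \<in> eigenspace p \<alpha>" "y \<in> eigenspace p \<beta>"
    "\<alpha> \<in> {1, 0, 1/4, 1/32}" "\<beta> \<in> {1, 0, 1/4, 1/32}"
  shows "mult x y \<in> span (\<Union>\<nu>\<in>monster_fusion \<alpha> \<beta>. eigenspace p \<nu>)"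
  using assms unfolding monster_axis_def monster_eigenvalues_def by blast

lemma fusion_zero_zero:
  assumes "monster_axis p" "x \<in> eigenspace p 0" "y \<in> eigenspace p 0"
  shows "mult x y \<in> eigenspace p 0"
  using fusion[OF assms] by (simp add: monster_fusion_simps span_eq_iff[THEN iffD2, OF subspace_eigenspace])

lemma fusion_zero_quarter:
  assumes "monster_axis p" "x \<in> eigenspace p 0" "y \<in> eigenspace p (1/4)"
  shows "mult x y \<in> eigenspace p (1/4)"
  using fusion[OF assms] by (simp add: monster_fusion_simps span_eq_iff[THEN iffD2, OF subspace_eigenspace])

text \<open>The \<open>1\<close>-eigenspace is spanned by \<open>p\<close>, so the part of the product outside the \<open>0\<close>-eigenspace is a
  multiple of \<open>p\<close>.\<close>

lemma fusion_quarter_quarter: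
  assumes p: "monster_axis p" and "x \<in> eigenspace p (1/4)" "y \<in> eigenspace p (1/4)"
  obtains r where "mult x y - scale r p \<in> eigenspace p 0"
proof -
  have "mult x y \<in> span (eigenspace p 1 \<union> eigenspace p 0)"
    using fusion[OF assms] by (simp add: monster_fusion_simps)
  then obtain u w where *: "mult x y = u + w" "u \<in> eigenspace p 1" "w \<in> eigenspace p 0"
    by (auto simp: span_Un span_eq_iff[THEN iffD2, OF subspace_eigenspace])
  from *(2) p have "u \<in> span {p}" by (simp add: monster_axis_def)
  then obtain r where "u = scale r p" by (auto simp: span_singleton)
  with * that[of r] show ?thesis by simp
qed

lemma even_part_times_even_part:
  assumes p: "monster_axis p" and x: "x \<in> even_part p" and y: "y \<in> even_part p"
  shows "mult x y \<in> even_part p"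
proof -
  obtain r v0 v4 where v: "x = scale r p + v0 + v4" "v0 \<in> eigenspace p 0" "v4 \<in> eigenspace p (1/4)"
    by (rule even_part_decomposition[OF p x])
  obtain s w0 w4 where w: "y = scale s p + w0 + w4" "w0 \<in> eigenspace p 0" "w4 \<in> eigenspace p (1/4)"
    by (rule even_part_decomposition[OF p y])
  obtain t where "mult v4 w4 - scale t p \<in> eigenspace p 0"
    by (rule fusion_quarter_quarter[OF p v(3) w(3)])
  then have "(mult v4 w4 - scale t p) + scale t p \<in> even_part p"
    using eigenspace_even_part(2) axis_in_even_part[OF p] subspace_even_part
    by (intro subspace_add subspace_scale) auto
  then have "mult v4 w4 \<in> even_part p" by simp
  moreover have "mult v0 w0 \<in> even_part p" "mult v0 w4 \<in> even_part p" "mult v4 w0 \<in> even_part p"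
    using fusion_zero_zero[OF p v(2) w(2)] fusion_zero_quarter[OF p v(2) w(3)]
      fusion_zero_quarter[OF p w(2) v(3)] eigenspace_even_part[THEN subsetD]
    unfolding mult_commute[of w0] by blast+
  moreover have "v4 \<in> even_part p" "w4 \<in> even_part p" using v w eigenspace_even_part by blast+
  moreover have "mult v0 p = 0" "mult p w0 = 0" "mult v4 p = scale (1/4) v4" "mult p w4 = scale (1/4) w4"
    "mult p p = p"
    using v w p by (auto simp: eigenspace_iff mult_commute monster_axis_def)
  ultimately show ?thesis
    unfolding v(1) w(1) using subspace_even_part axis_in_even_part[OF p]
    by (simp add: mult_linear subspace_add subspace_scale)
qed

lemma even_part_times_odd:
  assumes p: "monster_axis p" and x: "x \<in> even_part p" and y: "y \<in> eigenspace p (1/32)"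
  shows "mult x y \<in> eigenspace p (1/32)"
proof -
  obtain r v0 v4 where v: "x = scale r p + v0 + v4" "v0 \<in> eigenspace p 0" "v4 \<in> eigenspace p (1/4)"
    by (rule even_part_decomposition[OF p x])
  have "mult v0 y \<in> eigenspace p (1/32)" "mult v4 y \<in> eigenspace p (1/32)"
    using fusion[OF p v(2) y] fusion[OF p v(3) y]
    by (simp_all add: monster_fusion_simps span_eq_iff[THEN iffD2, OF subspace_eigenspace])
  moreover have "mult p y = scale (1/32) y" using y by (simp add: eigenspace_iff)
  ultimately show ?thesis
    unfolding v(1) using y by (simp add: mult_linear eigenspace_linear del: scale_scale)
qed

lemma odd_times_odd:
  assumes p: "monster_axis p" and x: "x \<in> eigenspace p (1/32)" and y: "y \<in> eigenspace p (1/32)"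
  shows "mult x y \<in> even_part p"
  using fusion[OF assms] by (simp add: monster_fusion_simps even_part_def Un_assoc)

definition automorphism :: "('v \<Rightarrow> 'v) \<Rightarrow> bool" where
  "automorphism \<phi> \<longleftrightarrow> (\<forall>x y. \<phi> (x + y) = \<phi> x + \<phi> y) \<and> (\<forall>r x. \<phi> (scale r x) = scale r (\<phi> x)) \<and>
     (\<forall>x y. \<phi> (mult x y) = mult (\<phi> x) (\<phi> y)) \<and> bij \<phi>"

text \<open>The fusion law is graded by a group of order two, so the sign change on the odd part respects
  products.\<close>

lemma automorphism_miyamoto:
  assumes p: "monster_axis p"
  shows "automorphism (miyamoto p)" and "miyamoto p (miyamoto p v) = v"
proof -
  have inv: "miyamoto p (miyamoto p v) = v" for v
  proof -
    obtain x y where v: "v = x + y" "x \<in> even_part p" "y \<in> eigenspace p (1/32)"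
      by (rule grading_decomposition[OF p])
    have "- y \<in> eigenspace p (1/32)" using eigenspace_linear(2)[OF v(3), of "-1"] by simp
    then show ?thesis using miyamoto_eq[OF p v(2), of "- y"] miyamoto_eq[OF p v(2,3)] v(1) by simp
  qed
  then show "miyamoto p (miyamoto p v) = v" by simp
  have "bij (miyamoto p)" by (rule o_bij[of "miyamoto p"]) (auto simp: fun_eq_iff inv)
  moreover have "miyamoto p (v + w) = miyamoto p v + miyamoto p w"
    and "miyamoto p (mult v w) = mult (miyamoto p v) (miyamoto p w)" for v w
  proof -
    obtain x y where v: "v = x + y" "x \<in> even_part p" "y \<in> eigenspace p (1/32)"
      by (rule grading_decomposition[OF p])
    obtain x' y' where w: "w = x' + y'" "x' \<in> even_part p" "y' \<in> eigenspace p (1/32)"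
      by (rule grading_decomposition[OF p])
    note tau = miyamoto_eq[OF p v(2,3)] miyamoto_eq[OF p w(2,3)]
    have "miyamoto p ((x + x') + (y + y')) = (x + x') - (y + y')"
      using v w by (intro miyamoto_eq p eigenspace_linear subspace_add subspace_even_part)
    moreover have "v + w = (x + x') + (y + y')" using v(1) w(1) by (simp add: algebra_simps)
    ultimately have "miyamoto p (v + w) = (x + x') - (y + y')" by (simp only:)
    then show "miyamoto p (v + w) = miyamoto p v + miyamoto p w"
      by (simp only:) (simp add: v(1) w(1) tau)
    have "miyamoto p ((mult x x' + mult y y') + (mult x y' + mult x' y)) =
        (mult x x' + mult y y') - (mult x y' + mult x' y)"
      using v w by (intro miyamoto_eq p eigenspace_linear subspace_add subspace_even_part
          even_part_times_even_part even_part_times_odd odd_times_odd)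
    moreover have "mult v w = (mult x x' + mult y y') + (mult x y' + mult x' y)"
      using v(1) w(1) by (simp add: mult_linear algebra_simps mult_commute)
    ultimately have "miyamoto p (mult v w) =
        (mult x x' + mult y y') - (mult x y' + mult x' y)" by (simp only:)
    then show "miyamoto p (mult v w) = mult (miyamoto p v) (miyamoto p w)"
      by (simp only:) (simp add: v(1) w(1) tau mult_linear algebra_simps mult_commute)
  qed
  moreover have "miyamoto p (scale r v) = scale r (miyamoto p v)" for r v
    unfolding miyamoto_alt[OF p] odd_projection_def Let_def
    by (rule eq_by_functionals) (simp add: mult_linear functional_simps field_simps)
  ultimately show "automorphism (miyamoto p)" by (simp add: automorphism_def)
qed

lemma automorphism_simps:
  assumes "automorphism \<phi>"
  shows "\<phi> (x + y) = \<phi> x + \<phi> y" "\<phi> (scale r x) = scale r (\<phi> x)" "\<phi> (mult x y) = mult (\<phi> x) (\<phi> y)"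
    "\<phi> (x - y) = \<phi> x - \<phi> y" "\<phi> 0 = 0" "\<phi> x = \<phi> y \<longleftrightarrow> x = y"
proof -
  note 1 = assms[unfolded automorphism_def]
  show "\<phi> (x + y) = \<phi> x + \<phi> y" "\<phi> (scale r x) = scale r (\<phi> x)" "\<phi> (mult x y) = mult (\<phi> x) (\<phi> y)"
    using 1 by blast+
  have "\<phi> (x - y) + \<phi> y = \<phi> x" using 1 by (metis diff_add_cancel)
  then show "\<phi> (x - y) = \<phi> x - \<phi> y" by (simp add: algebra_simps)
  have "\<phi> (0 + 0) = \<phi> 0 + \<phi> 0" using 1 by blast
  then show "\<phi> 0 = 0" by simp
  show "\<phi> x = \<phi> y \<longleftrightarrow> x = y" using 1 by (auto simp: bij_def inj_def)
qed

lemma automorphism_comp: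
  "automorphism \<phi> \<Longrightarrow> automorphism \<psi> \<Longrightarrow> automorphism (\<phi> \<circ> \<psi>)"
  by (auto simp: automorphism_def intro: bij_comp)

lemma automorphism_funpow: "automorphism \<phi> \<Longrightarrow> automorphism (\<phi> ^^ k)"
proof (induction k)
  case 0
  show ?case using bij_id by (simp add: automorphism_def id_def)
next
  case (Suc k)
  then show ?case unfolding funpow.simps by (simp add: automorphism_comp del: comp_apply)
qed

section \<open>Generated subalgebras and direct sums\<close>

lemma subalgebra_generated: "subalgebra (generated_subalgebra Y)"
  unfolding generated_subalgebra_def
  by (rule hull_in) (auto simp: subalgebra_def intro!: subspace_Inter)

lemma generated_subalgebra_base: "Y \<subseteq> generated_subalgebra Y"
  unfolding generated_subalgebra_def by (rule hull_subset)

lemma generated_subalgebra_minimal: "Y \<subseteq> S \<Longrightarrow> subalgebra S \<Longrightarrow> generated_subalgebra Y \<subseteq> S"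
  unfolding generated_subalgebra_def by (rule hull_minimal)

lemma automorphism_id:
  assumes "generated_subalgebra X = UNIV" "automorphism \<phi>" "\<And>x. x \<in> X \<Longrightarrow> \<phi> x = x"
  shows "\<phi> v = v"
proof -
  have add: "\<And>x y. \<phi> (x + y) = \<phi> x + \<phi> y" and "\<And>r x. \<phi> (scale r x) = scale r (\<phi> x)"
    and "\<And>x y. \<phi> (mult x y) = mult (\<phi> x) (\<phi> y)" using assms(2) by (auto simp: automorphism_def)
  moreover have "\<phi> 0 = 0" using add[of 0 0] by simp
  ultimately have "subalgebra {v. \<phi> v = v}" by (auto simp: subalgebra_def subspace_def)
  moreover have "X \<subseteq> {v. \<phi> v = v}" using assms(3) by blast
  ultimately show ?thesis using generated_subalgebra_minimal assms(1) by blast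
qed

text \<open>Two subalgebras that annihilate each other sum to a subalgebra, on which the product is
  componentwise.\<close>

lemma annihilating_direct_sum:
  assumes S: "subalgebra S" and T: "subalgebra T" and zero: "\<And>s t. s \<in> S \<Longrightarrow> t \<in> T \<Longrightarrow> mult s t = 0"
    and disjoint: "S \<inter> T \<subseteq> {0}" and generated: "generated_subalgebra (S \<union> T) = UNIV"
  shows "algebra_isomorphic scale mult UNIV (dsum_scale scale) (dsum_mult mult) (S \<times> T)"
proof -
  have subS: "subspace S" and mS: "\<And>v w. v \<in> S \<Longrightarrow> w \<in> S \<Longrightarrow> mult v w \<in> S"
    using S by (auto simp: subalgebra_def)
  have subT: "subspace T" and mT: "\<And>v w. v \<in> T \<Longrightarrow> w \<in> T \<Longrightarrow> mult v w \<in> T"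
    using T by (auto simp: subalgebra_def)
  define h where "h = (\<lambda>z :: 'v \<times> 'v. fst z + snd z)"
  let ?P = "S \<times> T"
  have add: "z + z' \<in> ?P" "h (z + z') = h z + h z'"
    and scl: "dsum_scale scale r z \<in> ?P" "h (dsum_scale scale r z) = scale r (h z)"
    and mul: "dsum_mult mult z z' \<in> ?P" "h (dsum_mult mult z z') = mult (h z) (h z')"
    if "z \<in> ?P" "z' \<in> ?P" for z z' r
    using that zero[of "fst z" "snd z'"] zero[of "fst z'" "snd z"]
    by (auto simp: h_def dsum_scale_def dsum_mult_def mem_Times_iff mult_linear scale_right_distrib
        mult_commute[of "snd z" "fst z'"] algebra_simps
        intro: subspace_add[OF subS] subspace_add[OF subT] subspace_scale[OF subS] subspace_scale[OF subT] mS mT)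
  have "inj_on h ?P"
  proof (rule inj_onI)
    fix z z' assume z: "z \<in> ?P" "z' \<in> ?P" "h z = h z'"
    then have "fst z - fst z' = snd z' - snd z" by (simp add: h_def algebra_simps)
    moreover have "fst z - fst z' \<in> S" "snd z' - snd z \<in> T"
      using z by (auto intro: subspace_diff[OF subS] subspace_diff[OF subT])
    ultimately have "fst z - fst z' = 0" "snd z' - snd z = 0" using disjoint by auto
    then show "z = z'" by (simp add: prod_eq_iff)
  qed
  moreover have "h ` ?P = UNIV"
  proof -
    have "h (0, 0) = 0" "(0, 0) \<in> ?P" using subspace_0[OF subS] subspace_0[OF subT] by (simp_all add: h_def)
    then have "0 \<in> h ` ?P" by force
    have "subalgebra (h ` ?P)"
      unfolding subalgebra_def subspace_def
    proof (intro conjI ballI allI)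
      show "0 \<in> h ` ?P" by fact
      fix v w assume "v \<in> h ` ?P" "w \<in> h ` ?P"
      then obtain z z' where "v = h z" "z \<in> ?P" "w = h z'" "z' \<in> ?P" by blast
      then show "v + w \<in> h ` ?P" "mult v w \<in> h ` ?P" "scale r v \<in> h ` ?P" for r
        using add[of z z'] mul[of z z'] scl[of z z r] by (metis imageI)+
    qed
    moreover have "S \<union> T \<subseteq> h ` ?P"
    proof
      fix v assume "v \<in> S \<union> T"
      then have "(v, 0) \<in> ?P \<or> (0, v) \<in> ?P" using subspace_0[OF subS] subspace_0[OF subT] by auto
      moreover have "h (v, 0) = v" "h (0, v) = v" by (simp_all add: h_def)
      ultimately show "v \<in> h ` ?P" by (metis imageI)
    qed
    ultimately show ?thesis using generated_subalgebra_minimal generated by blast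
  qed
  ultimately have bij: "bij_betw h ?P UNIV" by (simp add: bij_betw_def)
  define f where "f = inv_into ?P h"
  have fP: "f v \<in> ?P" and hf: "h (f v) = v" for v
    using bij by (simp_all add: f_def bij_betw_def inv_into_into f_inv_into_f)
  have fh: "f (h z) = z" if "z \<in> ?P" for z
    using bij that by (simp add: f_def bij_betw_def)
  have "algebra_iso scale mult UNIV (dsum_scale scale) (dsum_mult mult) ?P f"
    unfolding algebra_iso_def
  proof (intro conjI ballI allI)
    show "bij_betw f UNIV ?P" unfolding f_def by (rule bij_betw_inv_into[OF bij])
    show "f (v + w) = f v + f w" for v w
      using fh[OF add(1)[OF fP fP]] add(2)[OF fP fP] hf by metis
    show "f (scale r v) = dsum_scale scale r (f v)" for r v
      using fh[OF scl(1)[OF fP fP]] scl(2)[OF fP fP] hf by metis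
    show "f (mult v w) = dsum_mult mult (f v) (f w)" for v w
      using fh[OF mul(1)[OF fP fP]] mul(2)[OF fP fP] hf by metis
  qed
  then show ?thesis unfolding algebra_isomorphic_def by blast
qed

text \<open>The \<open>0\<close>-eigenspace of an axis is a subalgebra, so \<open>p\<close> annihilates everything that is generated by
  vectors it annihilates; being idempotent, it meets that subalgebra only in 0.\<close>

lemma annihilated_generators_direct_sum:
  assumes p: "monster_axis p" and zero: "\<And>y. y \<in> Y \<Longrightarrow> mult p y = 0"
    and generated: "generated_subalgebra (insert p Y) = UNIV"
  shows "algebra_isomorphic scale mult UNIV (dsum_scale scale) (dsum_mult mult)
      (generated_subalgebra {p} \<times> generated_subalgebra Y)"
proof (rule annihilating_direct_sum[OF subalgebra_generated subalgebra_generated])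
  have pp: "mult p p = p" using p by (simp add: monster_axis_def)
  have "subalgebra (span {p})"
    unfolding subalgebra_def by (intro conjI subspace_span) (auto simp: span_singleton mult_linear pp)
  then have Sp: "generated_subalgebra {p} \<subseteq> span {p}"
    by (intro generated_subalgebra_minimal) (auto intro: span_base)
  have "subalgebra (eigenspace p 0)"
    using fusion_zero_zero[OF p] subspace_eigenspace by (simp add: subalgebra_def)
  then have T: "generated_subalgebra Y \<subseteq> eigenspace p 0"
    by (intro generated_subalgebra_minimal) (auto simp: eigenspace_iff zero)
  show "mult s t = 0" if s: "s \<in> generated_subalgebra {p}" and t: "t \<in> generated_subalgebra Y" for s t
  proof -
    obtain r where "s = scale r p" using s Sp unfolding span_singleton by blast
    moreover have "mult p t = 0" using t T by (auto simp: eigenspace_iff)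
    ultimately show ?thesis by (simp add: mult_linear)
  qed
  show "generated_subalgebra {p} \<inter> generated_subalgebra Y \<subseteq> {0}"
  proof
    fix v assume v: "v \<in> generated_subalgebra {p} \<inter> generated_subalgebra Y"
    obtain r where "v = scale r p" using v Sp unfolding span_singleton by blast
    moreover have "mult p v = 0" using v T by (auto simp: eigenspace_iff)
    ultimately show "v \<in> {0}" by (simp add: mult_linear pp)
  qed
  have "insert p Y \<subseteq> generated_subalgebra {p} \<union> generated_subalgebra Y"
    using generated_subalgebra_base by blast
  then have "insert p Y \<subseteq> generated_subalgebra (generated_subalgebra {p} \<union> generated_subalgebra Y)"
    using generated_subalgebra_base by blast
  then show "generated_subalgebra (generated_subalgebra {p} \<union> generated_subalgebra Y) = UNIV"
    using generated_subalgebra_minimal[OF _ subalgebra_generated] generated by blast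
qed

end

section \<open>Dihedral subalgebras\<close>

lemma numerals_mod_2: "(2 :: 2) = 0" "(3 :: 2) = 1"
  by simp_all

lemma numerals_mod_3: "(3 :: 3) = 0" "(4 :: 3) = 1" "(-1 :: 3) = 2" "(-2 :: 3) = 1"
  by simp_all

lemma numerals_mod_5: "(5 :: 5) = 0" "(6 :: 5) = 1" "(7 :: 5) = 2" "(8 :: 5) = 3"
    "(-1 :: 5) = 4" "(-2 :: 5) = 3"
  by simp_all

lemma exhaust_mod_3: "(i :: 3) = 0 \<or> i = 1 \<or> i = 2"
  using exhaust_3[of i] by (auto simp: numerals_mod_3)

lemma UNIV_mod_3: "(UNIV :: 3 set) = {0, 1, 2}"
  using exhaust_mod_3 by auto

lemma exhaust_5: "(i :: 5) = 0 \<or> i = 1 \<or> i = 2 \<or> i = 3 \<or> i = 4"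
proof (cases i rule: bit1.cases)
  case (1 z)
  then have "z = 0 \<or> z = 1 \<or> z = 2 \<or> z = 3 \<or> z = 4" by auto
  with 1(1) show ?thesis by auto
qed

lemma UNIV_5: "(UNIV :: 5 set) = {0, 1, 2, 3, 4}"
  using exhaust_5 by auto

text \<open>For an odd modulus the shifts by 2 reach every index.\<close>

lemma two_generates_3: "\<exists>k. (i :: 3) = of_nat (2 * k)"
proof -
  have "(0 :: 3) = of_nat (2 * 0)" "(1 :: 3) = of_nat (2 * 2)" "(2 :: 3) = of_nat (2 * 1)"
    by (simp_all add: numerals_mod_3)
  then show ?thesis using exhaust_mod_3[of i] by metis
qed

lemma two_generates_5: "\<exists>k. (i :: 5) = of_nat (2 * k)"
proof -
  have "(0 :: 5) = of_nat (2 * 0)" "(1 :: 5) = of_nat (2 * 3)" "(2 :: 5) = of_nat (2 * 1)"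
    "(3 :: 5) = of_nat (2 * 4)" "(4 :: 5) = of_nat (2 * 2)"
    by (simp_all add: numerals_mod_5)
  then show ?thesis using exhaust_5[of i] by metis
qed

context comm_algebra
begin

lemma table_mult_basis: "table_mult T (basis_vec i) (basis_vec j) = T i j"
proof -
  have "table_mult T (basis_vec i) (basis_vec j) =
      (\<Sum>k\<in>UNIV. \<Sum>l\<in>UNIV. if l = j then if k = i then T i j else 0 else 0)"
    unfolding table_mult_def by (intro sum.cong refl) (simp add: axis_def)
  then show ?thesis by simp
qed

text \<open>The inverse of an isomorphism onto a model, as a linear map from the coordinate space. In this
  form the products of the model are computed by applying \<open>g\<close> to the table. The orbit
  statements can be pulled back because the involutions preserve the subalgebra generated by \<open>p\<close> and \<open>q\<close>.\<close>

lemma dihedral_model: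
  fixes T :: "'n::finite \<Rightarrow> 'n \<Rightarrow> 'f ^ 'n" and ax :: "nat \<Rightarrow> 'n"
  assumes iso: "dihedral_iso T ax p q" and axes: "monster_axis p" "monster_axis q"
  obtains g where "Vector_Spaces.linear (*s) scale g" "inj g"
    "\<And>i j. mult (g (basis_vec i)) (g (basis_vec j)) = g (T i j)"
    "\<And>k. ((miyamoto q \<circ> miyamoto p) ^^ k) p = g (basis_vec (ax (2 * k)))"
    "\<And>k. ((miyamoto q \<circ> miyamoto p) ^^ k) q = g (basis_vec (ax (1 + 2 * k)))"
proof -
  let ?S = "generated_subalgebra {p, q}" and ?r = "miyamoto q \<circ> miyamoto p"
  from iso obtain f where f: "algebra_iso scale mult ?S (*s) (table_mult T) UNIV f"
    and fp: "\<And>k. f ((?r ^^ k) p) = basis_vec (ax (2 * k))"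
    and fq: "\<And>k. f ((?r ^^ k) q) = basis_vec (ax (1 + 2 * k))"
    unfolding dihedral_iso_def Let_def by blast
  define g where "g = inv_into ?S f"
  have bij: "bij_betw f ?S UNIV" using f by (simp add: algebra_iso_def)
  have gf: "g (f v) = v" if "v \<in> ?S" for v
    using bij that by (simp add: g_def bij_betw_def inv_into_f_f)
  have fg: "f (g v) = v" and gS: "g v \<in> ?S" for v
    using bij by (simp_all add: g_def bij_betw_def f_inv_into_f inv_into_into)
  have sub: "subalgebra ?S" by (rule subalgebra_generated)
  then have sS: "subspace ?S" and mS: "\<And>x y. x \<in> ?S \<Longrightarrow> y \<in> ?S \<Longrightarrow> mult x y \<in> ?S"
    by (auto simp: subalgebra_def)
  have pq: "p \<in> ?S" "q \<in> ?S" using generated_subalgebra_base[of "{p, q}"] by auto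
  \<comment> \<open>This makes the inverse of \<open>f\<close> applicable to the orbit of \<open>p\<close> and \<open>q\<close>.\<close>
  have rS: "(?r ^^ k) v \<in> ?S" if "v \<in> ?S" for k v
    by (induction k) (auto simp: that intro: miyamoto_in_subalgebra axes sub pq)
  have "vector_space ((*s) :: 'f \<Rightarrow> 'f ^ 'n \<Rightarrow> 'f ^ 'n)" ..
  moreover have "vector_space scale" ..
  moreover have "g (v + w) = g v + g w" for v w
  proof -
    have "f (g v + g w) = v + w" using f gS by (simp add: algebra_iso_def fg)
    then show ?thesis using gf[OF subspace_add[OF sS gS gS]] by metis
  qed
  moreover have "g (r *s v) = scale r (g v)" for r v
  proof -
    have "f (scale r (g v)) = r *s v" using f gS by (simp add: algebra_iso_def fg)
    then show ?thesis using gf[OF subspace_scale[OF sS gS]] by metis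
  qed
  ultimately have lin: "Vector_Spaces.linear (*s) scale g"
    by (simp add: Vector_Spaces.linear_iff)
  have inj: "inj g" by (rule inj_on_inverseI[of _ f]) (rule fg)
  have table: "mult (g (basis_vec i)) (g (basis_vec j)) = g (T i j)" for i j
  proof -
    have "f (mult (g (basis_vec i)) (g (basis_vec j))) = T i j"
      using f gS by (simp add: algebra_iso_def fg table_mult_basis)
    then show ?thesis using gf[OF mS[OF gS gS]] by metis
  qed
  have orbits: "(?r ^^ k) p = g (basis_vec (ax (2 * k)))" "(?r ^^ k) q = g (basis_vec (ax (1 + 2 * k)))" for k
    using gf[OF rS[OF pq(1)], of k] gf[OF rS[OF pq(2)], of k] by (simp_all only: fp fq)
  show ?thesis by (rule that[OF lin inj table orbits])
qed

text \<open>Indices of the axes of 2A and 2B are taken modulo 2, so \<open>\<rho>\<close>, which shifts them by 2, fixes both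
  generators; each involution fixes its own axis, so it fixes the other one as well.\<close>

lemma two_generated_fixed:
  assumes "has_type p q L" "L \<in> {D2A, D2B}" "monster_axis p" "monster_axis q"
  shows "miyamoto p q = q" "miyamoto q p = p"
proof -
  have "miyamoto q (miyamoto p p) = p \<and> miyamoto q (miyamoto p q) = q"
  proof (cases "L = D2A")
    case True
    with assms(1,2) have iso: "dihedral_iso table_2A (\<lambda>n. Some (of_nat n)) p q" using assms(1) by simp
    obtain g :: "'f ^ 2 option \<Rightarrow> 'v" where
      g: "\<And>k. ((miyamoto q \<circ> miyamoto p) ^^ k) p = g (basis_vec (Some (of_nat (2 * k))))"
        "\<And>k. ((miyamoto q \<circ> miyamoto p) ^^ k) q = g (basis_vec (Some (of_nat (1 + 2 * k))))"
    by (rule dihedral_model[OF iso assms(3,4)]) (rule that, assumption+)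
    show ?thesis using g(1)[of 0] g(1)[of 1] g(2)[of 0] g(2)[of 1] by (simp add: numerals_mod_2)
  next
    case False
    with assms(1,2) have iso: "dihedral_iso table_2B of_nat p q" using assms(1,2) by auto
    obtain g :: "'f ^ 2 \<Rightarrow> 'v" where
      g: "\<And>k. ((miyamoto q \<circ> miyamoto p) ^^ k) p = g (basis_vec (of_nat (2 * k)))"
        "\<And>k. ((miyamoto q \<circ> miyamoto p) ^^ k) q = g (basis_vec (of_nat (1 + 2 * k)))"
    by (rule dihedral_model[OF iso assms(3,4)]) (rule that, assumption+)
    show ?thesis using g(1)[of 0] g(1)[of 1] g(2)[of 0] g(2)[of 1] by (simp add: numerals_mod_2)
  qed
  then show "miyamoto p q = q" "miyamoto q p = p"
    using miyamoto_fixes_even_part[OF assms(3) axis_in_even_part]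
      miyamoto_fixes_even_part[OF assms(4) axis_in_even_part] automorphism_miyamoto(2) assms(3,4)
    by metis+
qed

lemma product_2A:
  assumes "has_type p q D2A" "monster_axis p" "monster_axis q"
  obtains r where "mult p q = scale (1/8) (p + q - r)" "mult p r = scale (1/8) (p + r - q)"
    "mult q r = scale (1/8) (q + r - p)" "mult r r = r" "mult p q \<noteq> 0"
proof -
  have iso: "dihedral_iso table_2A (\<lambda>n. Some (of_nat n)) p q" using assms(1) by simp
  obtain g :: "'f ^ 2 option \<Rightarrow> 'v" where
    g: "Vector_Spaces.linear (*s) scale g" "inj g"
      "\<And>i j. mult (g (basis_vec i)) (g (basis_vec j)) = g (table_2A i j)"
      "\<And>k. ((miyamoto q \<circ> miyamoto p) ^^ k) p = g (basis_vec (Some (of_nat (2 * k))))"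
      "\<And>k. ((miyamoto q \<circ> miyamoto p) ^^ k) q = g (basis_vec (Some (of_nat (1 + 2 * k))))"
    by (rule dihedral_model[OF iso assms(2,3)]) (rule that, assumption+)
  interpret g: Vector_Spaces.linear "(*s)" scale g by (rule g)
  have p: "p = g (basis_vec (Some 0))" and q: "q = g (basis_vec (Some 1))"
    using g(4)[of 0] g(5)[of 0] by simp_all
  note lin = g.add g.diff g.scale
  have pq: "mult p q = g ((1/8) *s (basis_vec (Some 0) + basis_vec (Some 1) - basis_vec None))"
    unfolding p q by (simp add: g(3))
  have "((1/8) *s (basis_vec (Some 0) + basis_vec (Some 1) - basis_vec None) :: 'f ^ 2 option) $ None \<noteq> 0"
    by (simp add: axis_def)
  then have "(1/8) *s (basis_vec (Some 0) + basis_vec (Some 1) - basis_vec None) \<noteq> (0 :: 'f ^ 2 option)"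
    by (metis zero_index)
  then have "mult p q \<noteq> 0" unfolding pq using g(2) g.zero by (metis injD)
  then show ?thesis
    by (intro that[of "g (basis_vec None)"]) (simp_all add: pq, simp_all add: p q g(3) lin numerals_mod_2)
qed

lemma product_2B:
  assumes "has_type p q D2B" "monster_axis p" "monster_axis q"
  shows "mult p q = 0"
proof -
  have iso: "dihedral_iso table_2B of_nat p q" using assms(1) by simp
  obtain g :: "'f ^ 2 \<Rightarrow> 'v" where
    g: "Vector_Spaces.linear (*s) scale g"
      "\<And>i j. mult (g (basis_vec i)) (g (basis_vec j)) = g (table_2B i j)"
      "\<And>k. ((miyamoto q \<circ> miyamoto p) ^^ k) p = g (basis_vec (of_nat (2 * k)))"
      "\<And>k. ((miyamoto q \<circ> miyamoto p) ^^ k) q = g (basis_vec (of_nat (1 + 2 * k)))"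
    by (rule dihedral_model[OF iso assms(2,3)]) (rule that, assumption+)
  interpret g: Vector_Spaces.linear "(*s)" scale g by (rule g)
  have p: "p = g (basis_vec 0)" and q: "q = g (basis_vec 1)"
    using g(3)[of 0] g(4)[of 0] by simp_all
  show ?thesis by (simp add: p q g(2) table_2B_def g.zero)
qed

text \<open>If the shifts by 2 reach every index, the powers of \<open>\<rho>\<close> carry \<open>p\<close> to all the axes \<open>x i\<close>, and the
  involution of \<open>p\<close> acts on them as the reflection about 0.\<close>

lemma dihedral_orbit:
  fixes x :: "'m::comm_ring_1 \<Rightarrow> 'v" and p q :: 'v
  defines "\<rho> \<equiv> miyamoto q \<circ> miyamoto p"
  assumes axes: "monster_axis p" "monster_axis q"
    and orbit: "\<And>k. (\<rho> ^^ k) p = x (of_nat (2 * k))"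
    and odd_order: "\<And>i :: 'm. \<exists>k. i = of_nat (2 * k)"
  shows "\<rho> (x i) = x (i + 2)" and "miyamoto p (x i) = x (- i)"
proof -
  have step: "\<rho> (x i) = x (i + 2)" for i
  proof -
    obtain k where k: "i = of_nat (2 * k)" using odd_order by blast
    have "(of_nat (2 * Suc k) :: 'm) = i + 2" by (simp add: k)
    moreover have "\<rho> (x i) = (\<rho> ^^ Suc k) p" unfolding k orbit[symmetric] by simp
    ultimately show ?thesis unfolding orbit by (simp only:)
  qed
  show "\<rho> (x i) = x (i + 2)" by (rule step)
  obtain k where k: "i = of_nat (2 * k)" using odd_order by blast
  \<comment> \<open>\<open>\<tau>\<^sub>p\<close> inverts \<open>\<rho>\<close>, being one of the two reflections of which \<open>\<rho>\<close> is the product.\<close>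
  have reverse: "(\<rho> ^^ m) (miyamoto p ((\<rho> ^^ m) v)) = miyamoto p v" for m v
  proof (induction m arbitrary: v)
    case 0
    then show ?case by simp
  next
    case (Suc m)
    have "(\<rho> ^^ Suc m) (miyamoto p ((\<rho> ^^ Suc m) v)) =
        \<rho> ((\<rho> ^^ m) (miyamoto p ((\<rho> ^^ m) (\<rho> v))))"
      unfolding funpow_Suc_right[of m \<rho>, THEN fun_cong, unfolded comp_apply, symmetric] by simp
    also have "\<dots> = \<rho> (miyamoto p (\<rho> v))" by (simp only: Suc)
    also have "\<dots> = miyamoto p v"
      by (simp add: \<rho>_def automorphism_miyamoto(2)[OF axes(1)] automorphism_miyamoto(2)[OF axes(2)])
    finally show ?case .
  qed
  have steps: "(\<rho> ^^ m) (x j) = x (j + of_nat (2 * m))" for m j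
  proof (induction m)
    case 0
    then show ?case by simp
  next
    case (Suc m)
    have "(of_nat (2 * Suc m) :: 'm) = of_nat (2 * m) + 2" by simp
    then show ?case by (simp only: funpow.simps comp_apply Suc step add.assoc)
  qed
  have p: "p = x 0" using orbit[of 0] by simp
  have "(\<rho> ^^ k) (miyamoto p (x i)) = miyamoto p p"
    unfolding k orbit[symmetric] by (rule reverse)
  also have "\<dots> = x 0" using miyamoto_fixes_even_part[OF axes(1) axis_in_even_part[OF axes(1)]] p by simp
  also have "\<dots> = (\<rho> ^^ k) (x (- i))" unfolding steps k[symmetric] by simp
  finally have "(\<rho> ^^ k) (miyamoto p (x i)) = (\<rho> ^^ k) (x (- i))" .
  moreover have "automorphism (\<rho> ^^ k)"
    unfolding \<rho>_def by (intro automorphism_funpow automorphism_comp automorphism_miyamoto axes)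
  ultimately show "miyamoto p (x i) = x (- i)" using automorphism_simps(6) by blast
qed

text \<open>In dihedral algebras of odd type the two generating axes are conjugate; hence an axis
  fixed by their involutions is in the same position to both of them.\<close>

lemma odd_dihedral_conjugate:
  assumes "has_type p q M" "M \<in> {D3A, D3C, D5A}" "monster_axis p" "monster_axis q"
  obtains k where "((miyamoto q \<circ> miyamoto p) ^^ k) p = q"
proof -
  consider "M = D3A" | "M = D3C" | "M = D5A" using assms(2) by blast
  then show thesis
  proof cases
    case 1
    then have iso: "dihedral_iso table_3A (\<lambda>n. Some (of_nat n)) p q" using assms(1) by simp
    obtain g :: "'f ^ 3 option \<Rightarrow> 'v" where
      "\<And>k. ((miyamoto q \<circ> miyamoto p) ^^ k) p = g (basis_vec (Some (of_nat (2 * k))))"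
      "\<And>k. ((miyamoto q \<circ> miyamoto p) ^^ k) q = g (basis_vec (Some (of_nat (1 + 2 * k))))"
      by (rule dihedral_model[OF iso assms(3,4)]) (rule that, assumption+)
    \<comment> \<open>\<open>2 * 2 = 1\<close> modulo 3, so \<open>\<rho>\<^sup>2\<close> moves \<open>a\<^sub>0\<close> to \<open>a\<^sub>1\<close>.\<close>
    from this(1)[of 2] this(2)[of 0] that[of 2] show ?thesis by (simp add: numerals_mod_3)
  next
    case 2
    then have iso: "dihedral_iso table_3C of_nat p q" using assms(1) by simp
    obtain g :: "'f ^ 3 \<Rightarrow> 'v" where
      "\<And>k. ((miyamoto q \<circ> miyamoto p) ^^ k) p = g (basis_vec (of_nat (2 * k)))"
      "\<And>k. ((miyamoto q \<circ> miyamoto p) ^^ k) q = g (basis_vec (of_nat (1 + 2 * k)))"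
      by (rule dihedral_model[OF iso assms(3,4)]) (rule that, assumption+)
    from this(1)[of 2] this(2)[of 0] that[of 2] show ?thesis by (simp add: numerals_mod_3)
  next
    case 3
    then have iso: "dihedral_iso table_5A (\<lambda>n. Some (of_nat n)) p q" using assms(1) by simp
    obtain g :: "'f ^ 5 option \<Rightarrow> 'v" where
      "\<And>k. ((miyamoto q \<circ> miyamoto p) ^^ k) p = g (basis_vec (Some (of_nat (2 * k))))"
      "\<And>k. ((miyamoto q \<circ> miyamoto p) ^^ k) q = g (basis_vec (Some (of_nat (1 + 2 * k))))"
      by (rule dihedral_model[OF iso assms(3,4)]) (rule that, assumption+)
    \<comment> \<open>\<open>2 * 3 = 1\<close> modulo 5, so \<open>\<rho>\<^sup>3\<close> moves \<open>a\<^sub>0\<close> to \<open>a\<^sub>1\<close>.\<close>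
    from this(1)[of 3] this(2)[of 0] that[of 3] show ?thesis by (simp add: numerals_mod_5)
  qed
qed

end

section \<open>The Peirce decomposition of an axis with trivial involution\<close>

text \<open>An axis \<open>a\<close> without eigenvalue \<open>1/32\<close>. What remains of the fusion law is graded once more: \<open>1\<close> and \<open>0\<close> are of one
  parity, called symmetric, and \<open>1/4\<close> is of the other, called skew. Comparing parities splits every
  vector equation in two.\<close>

locale quarter_axis = comm_algebra scale mult
  for scale :: "'f::field_char_0 \<Rightarrow> 'v::ab_group_add \<Rightarrow> 'v" and mult :: "'v \<Rightarrow> 'v \<Rightarrow> 'v" +
  fixes a :: 'v
  assumes axis_a: "monster_axis a" and all_even: "v \<in> even_part a"
begin

text \<open>Equivalent to lying in the sum of the \<open>1\<close>- and the \<open>0\<close>-eigenspace, and easier to propagate.\<close>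

definition symm :: "'v \<Rightarrow> bool" where
  "symm v \<longleftrightarrow> (\<exists>r. mult a v = scale r a)"

definition skew :: "'v \<Rightarrow> bool" where
  "skew v \<longleftrightarrow> mult a v = scale (1/4) v"

lemma aa: "mult a a = a" and a_nonzero: "a \<noteq> 0"
  using axis_a by (simp_all add: monster_axis_def)

lemma peirce_decomposition:
  obtains r v0 v4 where "v = scale r a + v0 + v4" "mult a v0 = 0" "skew v4"
proof -
  obtain r v0 v4 where "v = scale r a + v0 + v4" "v0 \<in> eigenspace a 0" "v4 \<in> eigenspace a (1/4)"
    by (rule even_part_decomposition[OF axis_a all_even[of v]])
  then show ?thesis using that by (simp add: eigenspace_iff skew_def)
qed

lemma symm_decomposition:
  assumes "symm v"
  obtains r v0 where "v = scale r a + v0" "mult a v0 = 0"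
proof -
  obtain r where "mult a v = scale r a" using assms unfolding symm_def by blast
  then have "mult a (v - scale r a) = 0" by (simp add: mult_linear aa)
  then show ?thesis using that[of r "v - scale r a"] by simp
qed

lemma symm_skew_linear:
  "symm v \<Longrightarrow> symm w \<Longrightarrow> symm (v + w)" "symm v \<Longrightarrow> symm w \<Longrightarrow> symm (v - w)"
  "symm v \<Longrightarrow> symm (scale r v)" "symm v \<Longrightarrow> symm (- v)" "symm 0" "symm a"
  "skew v \<Longrightarrow> skew w \<Longrightarrow> skew (v + w)" "skew v \<Longrightarrow> skew w \<Longrightarrow> skew (v - w)"
  "skew v \<Longrightarrow> skew (scale r v)" "skew v \<Longrightarrow> skew (- v)" "skew 0"
proof -
  show "symm (v + w)" "symm (v - w)" if v: "symm v" and w: "symm w"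
  proof -
    obtain r s where "mult a v = scale r a" "mult a w = scale s a" using v w unfolding symm_def by blast
    then have "mult a (v + w) = scale (r + s) a" "mult a (v - w) = scale (r - s) a"
      by (simp_all only: mult_linear scale_left_distrib scale_left_diff_distrib)
    then show "symm (v + w)" "symm (v - w)" unfolding symm_def by blast+
  qed
  show scale: "symm (scale r v)" if v: "symm v" for r v
  proof -
    obtain s where "mult a v = scale s a" using v unfolding symm_def by blast
    then have "mult a (scale r v) = scale (r * s) a" by (simp only: mult_linear scale_scale)
    then show ?thesis unfolding symm_def by blast
  qed
  show "symm v \<Longrightarrow> symm (- v)" using scale[of v "-1"] by simp
  have "mult a 0 = scale 0 a" "mult a a = scale 1 a" by (simp_all add: aa)
  then show "symm 0" "symm a" unfolding symm_def by blast+
qed (simp_all add: skew_def mult_linear scale_right_distrib scale_right_diff_distrib mult.commute)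

lemma symm_if_annihilated: "mult a v = 0 \<Longrightarrow> symm v"
  unfolding symm_def by (metis scale_zero_left)

lemma zero_products:
  assumes "mult a v = 0"
  shows "mult a w = 0 \<Longrightarrow> mult a (mult v w) = 0" "skew w \<Longrightarrow> skew (mult v w)"
  using fusion_zero_zero[OF axis_a, of v w] fusion_zero_quarter[OF axis_a, of v w] assms
  by (simp_all add: eigenspace_iff skew_def)

lemma symm_skew_products:
  "symm v \<Longrightarrow> symm w \<Longrightarrow> symm (mult v w)" "symm v \<Longrightarrow> skew w \<Longrightarrow> skew (mult v w)"
  "skew v \<Longrightarrow> symm w \<Longrightarrow> skew (mult v w)" "skew v \<Longrightarrow> skew w \<Longrightarrow> symm (mult v w)"
proof -
  show "symm (mult v w)" if sv: "symm v" and sw: "symm w" for v w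
  proof -
    obtain r v0 where v: "v = scale r a + v0" "mult a v0 = 0" by (rule symm_decomposition[OF sv])
    obtain s w0 where w: "w = scale s a + w0" "mult a w0 = 0" by (rule symm_decomposition[OF sw])
    have "mult v w = scale (r * s) a + mult v0 w0"
      unfolding v(1) w(1) by (simp add: mult_linear aa w(2) v(2)[unfolded mult_commute[of a]])
    then show ?thesis using zero_products(1)[OF v(2) w(2)]
      by (simp add: symm_skew_linear symm_if_annihilated)
  qed
  show *: "skew (mult v w)" if sv: "symm v" and sw: "skew w" for v w
  proof -
    obtain r v0 where v: "v = scale r a + v0" "mult a v0 = 0" by (rule symm_decomposition[OF sv])
    have "mult v w = scale (r/4) w + mult v0 w"
      unfolding v(1) using sw by (simp add: mult_linear skew_def)
    then show ?thesis using zero_products(2)[OF v(2) sw] sw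
      by (simp add: symm_skew_linear)
  qed
  show "skew v \<Longrightarrow> symm w \<Longrightarrow> skew (mult v w)" using *[of w v] by (simp add: mult_commute)
  show "symm (mult v w)" if vw: "skew v" "skew w" for v w
  proof -
    obtain r where "mult v w - scale r a \<in> eigenspace a 0"
      by (rule fusion_quarter_quarter[OF axis_a, of v w]) (use vw in \<open>simp_all add: skew_def eigenspace_iff\<close>)
    then have "symm ((mult v w - scale r a) + scale r a)"
      by (intro symm_skew_linear symm_if_annihilated) (simp add: eigenspace_iff)
    then show ?thesis by simp
  qed
qed

text \<open>If a symmetric vector equals a skew vector \<open>v\<close>, then \<open>v\<close> is a multiple of \<open>a\<close>, whose eigenvalues \<open>1\<close> and
  \<open>1/4\<close> agree only on 0.\<close>

lemma parity:
  assumes "v + w = v' + w'" "symm v" "symm v'" "skew w" "skew w'"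
  shows "v = v'" "w = w'"
proof -
  have "symm (v - v')" using assms by (simp add: symm_skew_linear)
  then obtain r where r: "mult a (v - v') = scale r a" unfolding symm_def by blast
  have o: "skew (w' - w)" using assms by (simp add: symm_skew_linear)
  have e: "v - v' = w' - w" using assms(1) by (simp add: algebra_simps)
  have D: "scale (1/4) (w' - w) = scale r a" using o r e by (simp add: skew_def)
  then have "scale 4 (scale (1/4) (w' - w)) = scale 4 (scale r a)" by (simp only:)
  then have "mult a (w' - w) = scale (4 * r) a" by (simp add: mult_linear aa)
  then have "scale (4 * r) a = scale r a" using r e by simp
  then have "r = 0" using a_nonzero by simp
  then have "w' - w = 0" using D by simp
  then show "v = v'" "w = w'" using e by simp_all
qed

lemma parity_zero: "v + w = 0 \<Longrightarrow> symm v \<Longrightarrow> skew w \<Longrightarrow> v = 0" "v + w = 0 \<Longrightarrow> symm v \<Longrightarrow> skew w \<Longrightarrow> w = 0"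
  using parity[of v w 0 0] by (simp_all add: symm_skew_linear)

end

section \<open>Orbits of axes that form 2A algebras with a fixed axis\<close>

text \<open>The dihedral orbit of an axis \<open>x 0\<close> that generates a 2A algebra together with \<open>a\<close>. Rotations and
  reflections fix \<open>a\<close>, so facts about \<open>x 0\<close> are transported to all \<open>x i\<close>. The indices form a ring so that
  orbits of length 3 and 5 are treated together.\<close>

locale orbit_2A = quarter_axis scale mult a
  for scale :: "'f::field_char_0 \<Rightarrow> 'v::ab_group_add \<Rightarrow> 'v" and mult :: "'v \<Rightarrow> 'v \<Rightarrow> 'v" and a :: 'v +
  fixes x :: "'n::comm_ring_1 \<Rightarrow> 'v" and \<rho> :: "'v \<Rightarrow> 'v"
  assumes axis_x: "monster_axis (x 0)"
    and reflection: "miyamoto (x 0) a = a" "miyamoto (x 0) (x i) = x (- i)"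
    and rotation: "automorphism \<rho>" "\<rho> a = a" "\<rho> (x i) = x (i + 2)"
    and odd_order: "\<exists>k. i = of_nat (2 * k)"
    and two_A_products: "\<exists>r. mult a (x 0) = scale (1/8) (a + x 0 - r) \<and> mult a r = scale (1/8) (a + r - x 0) \<and>
      mult (x 0) r = scale (1/8) (x 0 + r - a) \<and> mult r r = r"
begin

text \<open>\<open>Y i\<close> and \<open>Z i\<close> are the \<open>1/4\<close>- and \<open>0\<close>-components of \<open>x i\<close> with respect to \<open>a\<close>; in the 2A algebra
  with third axis \<open>r\<close> they are \<open>(x i - r) / 2\<close> and \<open>(x i + r) / 2 - a / 8\<close>. Defining them through products with \<open>a\<close>
  makes them commute with every automorphism fixing \<open>a\<close>.\<close>

definition Y :: "'n \<Rightarrow> 'v" where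
  "Y i = scale 4 (mult a (x i)) - scale (1/2) a"

definition Z :: "'n \<Rightarrow> 'v" where
  "Z i = x i - Y i - scale (1/8) a"

lemma x_eq: "x i = scale (1/8) a + Z i + Y i"
  by (simp add: Z_def)

lemma translation:
  obtains \<phi> where "automorphism \<phi>" "\<phi> a = a" "\<And>i. \<phi> (x i) = x (i + d)"
    "\<And>i. \<phi> (Y i) = Y (i + d)" "\<And>i. \<phi> (Z i) = Z (i + d)"
proof -
  obtain k where k: "d = of_nat (2 * k)" using odd_order by blast
  have aut: "automorphism (\<rho> ^^ k)" by (rule automorphism_funpow[OF rotation(1)])
  have fixa: "(\<rho> ^^ m) a = a" for m by (induction m) (simp_all add: rotation(2))
  have move: "(\<rho> ^^ m) (x i) = x (i + of_nat (2 * m))" for m i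
  proof (induction m)
    case 0
    then show ?case by simp
  next
    case (Suc m)
    have "(of_nat (2 * Suc m) :: 'n) = of_nat (2 * m) + 2" by simp
    then show ?case by (simp only: funpow.simps comp_apply Suc rotation(3) add.assoc)
  qed
  note simps = automorphism_simps[OF aut] fixa move k
  show ?thesis by (rule that[OF aut fixa]) (simp_all only: Z_def Y_def simps)
qed

lemma products_0:
  "mult a (Y 0) = scale (1/4) (Y 0)" "mult a (Z 0) = 0"
  "mult (Z 0) (Y 0) = scale (15/32) (Y 0)"
  "mult (Y 0) (Y 0) = scale (7/64) a + scale (3/8) (Z 0)"
  "mult (Z 0) (Z 0) = scale (5/8) (Z 0)"
proof -
  obtain r where r: "mult a (x 0) = scale (1/8) (a + x 0 - r)" "mult a r = scale (1/8) (a + r - x 0)"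
      "mult (x 0) r = scale (1/8) (x 0 + r - a)" "mult r r = r"
    using two_A_products by blast
  have xx: "mult (x 0) (x 0) = x 0" using axis_x by (simp add: monster_axis_def)
  have Y: "Y 0 = scale (1/2) (x 0) - scale (1/2) r"
    unfolding Y_def r(1) by (rule eq_by_functionals) (simp add: functional_simps field_simps)
  have Z: "Z 0 = scale (1/2) (x 0) + scale (1/2) r - scale (1/8) a"
    unfolding Z_def Y by (rule eq_by_functionals) (simp add: functional_simps field_simps)
  note prods = r aa xx mult_commute[of "x 0" a] mult_commute[of r a] mult_commute[of r "x 0"]
  show "mult a (Y 0) = scale (1/4) (Y 0)" "mult a (Z 0) = 0"
    "mult (Z 0) (Y 0) = scale (15/32) (Y 0)"
    "mult (Y 0) (Y 0) = scale (7/64) a + scale (3/8) (Z 0)"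
    "mult (Z 0) (Z 0) = scale (5/8) (Z 0)"
    unfolding Y Z
    by (rule eq_by_functionals, simp add: functional_simps mult_linear prods, simp add: field_simps)+
qed

text \<open>The 2A table in terms of the components, valid for every index by translation.\<close>

lemma products:
  "skew (Y i)" "mult a (Y i) = scale (1/4) (Y i)" "mult (Y i) a = scale (1/4) (Y i)"
  "mult a (Z i) = 0" "mult (Z i) a = 0"
  "mult (Z i) (Y i) = scale (15/32) (Y i)" "mult (Y i) (Z i) = scale (15/32) (Y i)"
  "mult (Y i) (Y i) = scale (7/64) a + scale (3/8) (Z i)"
  "mult (Z i) (Z i) = scale (5/8) (Z i)"
proof -
  obtain \<phi> where \<phi>: "automorphism \<phi>" "\<phi> a = a" "\<And>j. \<phi> (Y j) = Y (j + i)" "\<And>j. \<phi> (Z j) = Z (j + i)"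
    by (rule translation[of i]) (rule that, assumption+)
  show "mult a (Y i) = scale (1/4) (Y i)" "mult a (Z i) = 0" "mult (Z i) (Y i) = scale (15/32) (Y i)"
    "mult (Y i) (Y i) = scale (7/64) a + scale (3/8) (Z i)"
    "mult (Z i) (Z i) = scale (5/8) (Z i)"
    using products_0[THEN arg_cong[of _ _ \<phi>]] by (simp_all add: automorphism_simps[OF \<phi>(1)] \<phi>(2-4))
  then show "skew (Y i)" "mult (Y i) a = scale (1/4) (Y i)" "mult (Z i) a = 0"
      "mult (Y i) (Z i) = scale (15/32) (Y i)"
    by (simp_all add: skew_def mult_commute)
qed

lemma symm_Z: "symm (Z i)" and skew_Y: "skew (Y i)"
  using products(1) products(4) symm_if_annihilated by auto

lemmas parities = symm_Z skew_Y symm_skew_linear symm_skew_products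

lemma reflected_products:
  "mult (Z i) (Z (i + d) - Z (i - d)) = scale (1/32) (Z (i + d) - Z (i - d))"
  "mult (Y i) (Z (i + d)) = mult (Y i) (Z (i - d))"
  "mult (Y i) (Y (i + d)) = mult (Y i) (Y (i - d))"
  "mult (Z i) (Y (i + d)) = mult (Z i) (Y (i - d))"
proof -
  have tau_Y: "miyamoto (x 0) (Y j) = Y (- j)" and tau_Z: "miyamoto (x 0) (Z j) = Z (- j)" for j
    by (simp_all add: Z_def Y_def automorphism_simps[OF automorphism_miyamoto(1)[OF axis_x]] reflection)
  note tau = automorphism_simps[OF automorphism_miyamoto(1)[OF axis_x]] tau_Y tau_Z
  \<comment> \<open>The reflection \<open>\<tau>\<close> of \<open>x 0\<close> negates these differences, so they lie in its
    \<open>1/32\<close>-eigenspace; the two parities are then compared.\<close>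
  have "mult (x 0) (Z d - Z (- d)) = scale (1/32) (Z d - Z (- d))"
    unfolding eigenspace_iff[symmetric] miyamoto_negates_iff[OF axis_x, symmetric] by (simp add: tau)
  then have Zd: "mult (Z 0) (Z d - Z (- d)) + mult (Y 0) (Z d - Z (- d)) = scale (1/32) (Z d - Z (- d)) + 0"
    unfolding x_eq[of 0] by (simp add: mult_linear products algebra_simps)
  have "mult (x 0) (Y d - Y (- d)) = scale (1/32) (Y d - Y (- d))"
    unfolding eigenspace_iff[symmetric] miyamoto_negates_iff[OF axis_x, symmetric] by (simp add: tau)
  then have Yd: "mult (Y 0) (Y d - Y (- d)) + mult (Z 0) (Y d - Y (- d)) = 0 + 0"
    unfolding x_eq[of 0]
    by (simp add: mult_linear products algebra_simps)
  have zero: "mult (Z 0) (Z d - Z (- d)) = scale (1/32) (Z d - Z (- d))"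
    "mult (Y 0) (Z d - Z (- d)) = 0" "mult (Y 0) (Y d - Y (- d)) = 0" "mult (Z 0) (Y d - Y (- d)) = 0"
    using parity[OF Zd] parity[OF Yd] by (simp_all add: parities)
  obtain \<phi> where \<phi>: "automorphism \<phi>" "\<phi> a = a" "\<And>j. \<phi> (Y j) = Y (j + i)" "\<And>j. \<phi> (Z j) = Z (j + i)"
    by (rule translation[of i]) (rule that, assumption+)
  show "mult (Z i) (Z (i + d) - Z (i - d)) = scale (1/32) (Z (i + d) - Z (i - d))"
    "mult (Y i) (Z (i + d)) = mult (Y i) (Z (i - d))"
    "mult (Y i) (Y (i + d)) = mult (Y i) (Y (i - d))"
    "mult (Z i) (Y (i + d)) = mult (Z i) (Y (i - d))"
    using zero[THEN arg_cong[of _ _ \<phi>]]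
    by (simp_all add: automorphism_simps[OF \<phi>(1)] \<phi>(2-4) mult_diff_right add.commute)
qed

text \<open>The main use of odd order: the reflections connect the pair of indices \<open>(i, j)\<close> with \<open>(j, i)\<close>.\<close>

lemma Z_times_Y_commute: "mult (Z i) (Y j) = mult (Y i) (Z j)"
proof -
  \<comment> \<open>Two reflections compose to a translation by \<open>2 * d\<close>; translating \<open>(i, i + d)\<close> by \<open>d\<close>, which is
    possible because \<open>-1\<close> is an even multiple of \<open>1\<close>, gives \<open>(i + d, i + 2 * d)\<close>, and one more reflection
    gives \<open>(i + d, i)\<close>.\<close>
  have shift: "mult (Z i) (Y (i + d)) = mult (Z (i - 2 * d)) (Y (i - 2 * d + d))" for i d
    using reflected_products(4)[of i d] reflected_products(2)[of "i - d" d]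
    by (simp add: mult_commute algebra_simps)
  have shifts: "mult (Z i) (Y (i + d)) = mult (Z (i - of_nat (2 * k) * d)) (Y (i - of_nat (2 * k) * d + d))" for i d k
  proof (induction k)
    case 0
    then show ?case by simp
  next
    case (Suc k)
    with shift[of "i - of_nat (2 * k) * d" d] show ?case by (simp add: algebra_simps)
  qed
  obtain k where k: "- 1 = (of_nat (2 * k) :: 'n)" using odd_order by metis
  let ?d = "j - i"
  have "mult (Y i) (Z j) = mult (Z (i + ?d)) (Y (i + ?d - ?d))" by (simp add: mult_commute)
  also have "\<dots> = mult (Z (i + ?d)) (Y (i + ?d + ?d))" by (rule reflected_products(4)[symmetric])
  also have "\<dots> = mult (Z i) (Y (i + ?d))"
    using shifts[of i ?d k] unfolding k[symmetric] by (simp add: algebra_simps)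
  finally show ?thesis by simp
qed

text \<open>Inside the 2A algebra, with third axis \<open>r = x 0 - 2 Y\<^sub>0\<close>, the axis \<open>x 0\<close> has the \<open>1/4\<close>-eigenvector
  \<open>r - a\<close> and the \<open>0\<close>-eigenvector \<open>a + r - x 0 / 4\<close>.\<close>

lemma quarter_times: "mult (x 0) (x 0 - scale 2 (Y 0) - a) = scale (1/4) (x 0 - scale 2 (Y 0) - a)"
  unfolding x_eq[of 0]
  by (rule eq_by_functionals, simp add: functional_simps mult_linear products aa, simp add: field_simps)

lemma zero_times: "mult (x 0) (a + scale (3/4) (x 0) - scale 2 (Y 0)) = 0"
  unfolding x_eq[of 0]
  by (rule eq_by_functionals, simp add: functional_simps mult_linear products aa, simp add: field_simps)

text \<open>The product of \<open>n\<close> with the two eigenvectors just found is governed by the fusion law of \<open>x 0\<close>. Solving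
  the resulting pair of equations gives the action of \<open>x 0\<close> on \<open>a n\<close> and \<open>Y\<^sub>0 n\<close> without knowing these
  products.\<close>

lemma zero_eigenvector_products:
  assumes n: "mult (x 0) n = 0"
  shows "mult (x 0) (mult a n) = scale (1/4) (mult (Y 0) n) + scale (1/8) (mult a n)"
    "mult (x 0) (mult (Y 0) n) = scale (1/8) (mult (Y 0) n) + scale (1/16) (mult a n)"
proof -
  have "mult (x 0) (mult (a + scale (3/4) (x 0) - scale 2 (Y 0)) n) = 0"
    using fusion_zero_zero[OF axis_x, of "a + scale (3/4) (x 0) - scale 2 (Y 0)" n] zero_times n
    by (simp add: eigenspace_iff)
  then have 1: "mult (x 0) (mult a n) - scale 2 (mult (x 0) (mult (Y 0) n)) = 0"
    by (simp add: mult_linear n)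
  have "mult (x 0) (mult (x 0 - scale 2 (Y 0) - a) n) = scale (1/4) (mult (x 0 - scale 2 (Y 0) - a) n)"
    using fusion_zero_quarter[OF axis_x, of n "x 0 - scale 2 (Y 0) - a"] quarter_times n
    by (simp add: eigenspace_iff mult_commute)
  then have 2: "- scale 2 (mult (x 0) (mult (Y 0) n)) - mult (x 0) (mult a n) =
      - scale (1/2) (mult (Y 0) n) - scale (1/4) (mult a n)"
    by (simp add: mult_linear n scale_right_diff_distrib)
  show "mult (x 0) (mult a n) = scale (1/4) (mult (Y 0) n) + scale (1/8) (mult a n)"
    by (rule eq_by_combination2[OF 1 2, of _ _ "1/2" "-1/2"], rule eq_by_functionals)
      (simp add: functional_simps, simp add: field_simps)
  show "mult (x 0) (mult (Y 0) n) = scale (1/8) (mult (Y 0) n) + scale (1/16) (mult a n)"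
    by (rule eq_by_combination2[OF 1 2, of _ _ "-1/4" "-1/4"], rule eq_by_functionals)
      (simp add: functional_simps, simp add: field_simps)
qed

text \<open>The analogue for a \<open>1/4\<close>-eigenvector. Here the product with \<open>r - a\<close> may involve \<open>x 0\<close> itself, whence the
  unknown scalar \<open>\<nu>\<close>.\<close>

lemma quarter_eigenvector_products:
  assumes w: "mult (x 0) w = scale (1/4) w"
  obtains \<nu> where
    "mult (x 0) (mult a w - scale 2 (mult (Y 0) w)) = scale (1/4) (mult a w - scale 2 (mult (Y 0) w))"
    "mult (x 0) (mult a w + scale 2 (mult (Y 0) w)) = scale (1/16) w - scale \<nu> (x 0)"
proof -
  have "mult (x 0) (mult (a + scale (3/4) (x 0) - scale 2 (Y 0)) w) =
      scale (1/4) (mult (a + scale (3/4) (x 0) - scale 2 (Y 0)) w)"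
    using fusion_zero_quarter[OF axis_x, of "a + scale (3/4) (x 0) - scale 2 (Y 0)" w] zero_times w
    by (simp add: eigenspace_iff)
  then have 1: "mult (x 0) (mult a w - scale 2 (mult (Y 0) w)) = scale (1/4) (mult a w - scale 2 (mult (Y 0) w))"
    by (simp add: mult_linear w scale_right_distrib scale_right_diff_distrib)
  obtain \<nu> where "mult (x 0 - scale 2 (Y 0) - a) w - scale \<nu> (x 0) \<in> eigenspace (x 0) 0"
    by (rule fusion_quarter_quarter[OF axis_x, of "x 0 - scale 2 (Y 0) - a" w])
      (simp_all add: quarter_times w eigenspace_iff)
  moreover have "mult (x 0) (x 0) = x 0" using axis_x by (simp add: monster_axis_def)
  ultimately have 2: "scale (1/16) w - scale 2 (mult (x 0) (mult (Y 0) w)) - mult (x 0) (mult a w) = scale \<nu> (x 0)"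
    by (simp add: eigenspace_iff mult_linear w)
  have "mult (x 0) (mult a w + scale 2 (mult (Y 0) w)) = scale (1/16) w - scale \<nu> (x 0)"
    unfolding 2[symmetric] by (simp add: mult_linear)
  with 1 show ?thesis by (rule that)
qed

text \<open>The skew part of the first identity in \<open>zero_eigenvector_products\<close>: the unknown products \<open>Z\<^sub>0 N\<close> and
  \<open>Y\<^sub>0 n0\<close> occur in it with opposite signs, so they cancel when they are equal.\<close>

lemma skew_part_of_zero_eigenvector:
  assumes n: "mult (x 0) (scale r a + n0 + N) = 0" and n0: "mult a n0 = 0" and N: "skew N"
    and commute: "mult (Z 0) N = mult (Y 0) n0"
  shows "N = scale (8 * r) (Y 0)"
proof -
  have aN: "mult a N = scale (1/4) N" using N by (simp add: skew_def)
  have e1: "mult (x 0) (mult a (scale r a + n0 + N)) =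
      (scale (r/8) a + scale (1/4) (mult (Y 0) N)) +
      (scale (r/4) (Y 0) + scale (1/128) N + scale (1/4) (mult (Z 0) N))"
    unfolding x_eq[of 0]
    by (rule eq_by_functionals, simp add: functional_simps mult_linear products aa aN n0)
       (simp add: field_simps)
  have e2: "scale (1/4) (mult (Y 0) (scale r a + n0 + N)) + scale (1/8) (mult a (scale r a + n0 + N)) =
      (scale (1/4) (mult (Y 0) N) + scale (r/8) a) +
      (scale (r/16) (Y 0) + scale (1/4) (mult (Y 0) n0) + scale (1/32) N)"
    by (rule eq_by_functionals, simp add: functional_simps mult_linear products aa aN n0)
       (simp add: field_simps)
  have "scale (r/4) (Y 0) + scale (1/128) N + scale (1/4) (mult (Z 0) N) =
      scale (r/16) (Y 0) + scale (1/4) (mult (Y 0) n0) + scale (1/32) N"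
    by (rule parity(2)[OF zero_eigenvector_products(1)[OF n, unfolded e1 e2]])
      (use N symm_if_annihilated[OF n0] in \<open>blast intro: parities\<close>)+
  note * = this[unfolded commute]
  show ?thesis
    by (rule eq_by_combination[OF *, of _ _ "-128/3"], rule eq_by_functionals)
      (simp add: functional_simps, simp add: field_simps)
qed

text \<open>A \<open>0\<close>-eigenvector of \<open>x 0\<close> that is a combination of the axes with equal coefficients away from \<open>x 0\<close>
  determines \<open>Y 0\<close> as a multiple of the sum of all \<open>Y j\<close>. Hence all \<open>Y j\<close> coincide, and with them the axes.\<close>

lemma orbit_collapses:
  assumes fin: "finite (UNIV :: 'n set)"
    and zero: "mult (x 0) ((\<Sum>j\<in>UNIV. x j) - scale c (x 0)) = 0"
  shows "x i = x 0"
proof -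
  let ?m = "of_nat (card (UNIV :: 'n set)) :: 'f"
  define N where "N = (\<Sum>j\<in>UNIV. Y j) - scale c (Y 0)"
  define n0 where "n0 = (\<Sum>j\<in>UNIV. Z j) - scale c (Z 0)"
  have n0: "mult a n0 = 0" by (simp add: n0_def mult_linear mult_sum_right products)
  have "mult a N = scale (1/4) N"
    by (simp add: N_def mult_linear mult_sum_right products scale_sum_right scale_right_diff_distrib mult.commute)
  then have N: "skew N" by (simp add: skew_def)
  \<comment> \<open>Here the symmetry of \<open>Z\<^sub>i Y\<^sub>j\<close> in \<open>i\<close> and \<open>j\<close> enters.\<close>
  have commute: "mult (Z 0) N = mult (Y 0) n0"
    by (simp add: N_def n0_def mult_linear mult_sum_right Z_times_Y_commute products)
  have "(\<Sum>j\<in>UNIV. x j) = (\<Sum>j\<in>UNIV. scale (1/8) a + Z j + Y j)"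
    by (rule sum.cong[OF refl x_eq])
  then have sum: "(\<Sum>j\<in>UNIV. x j) = scale (?m / 8) a + (\<Sum>j\<in>UNIV. Z j) + (\<Sum>j\<in>UNIV. Y j)"
    unfolding sum.distrib scale_sum_left[symmetric] by simp
  have "(\<Sum>j\<in>UNIV. x j) - scale c (x 0) = scale ((?m - c) / 8) a + n0 + N"
    unfolding sum x_eq[of 0] N_def n0_def
    by (rule eq_by_functionals) (simp add: functional_simps field_simps)
  then have "N = scale (8 * ((?m - c) / 8)) (Y 0)"
    using zero by (intro skew_part_of_zero_eigenvector[OF _ n0 N commute]) simp
  moreover have "8 * ((?m - c) / 8) = ?m - c" by simp
  ultimately have Y0: "(\<Sum>j\<in>UNIV. Y j) = scale ?m (Y 0)"
    by (simp only: N_def scale_left_diff_distrib) simp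
  \<comment> \<open>The sum is invariant under translation, so it determines every \<open>Y i\<close> in the same way.\<close>
  obtain \<phi> where \<phi>: "automorphism \<phi>" "\<And>j. \<phi> (Y j) = Y (j + i)"
    by (rule translation[of i]) (rule that, assumption+)
  have "\<phi> (sum f A) = (\<Sum>j\<in>A. \<phi> (f j))" for f and A :: "'n set"
    by (induction A rule: infinite_finite_induct) (simp_all add: automorphism_simps[OF \<phi>(1)])
  then have "(\<Sum>j\<in>UNIV. Y (j + i)) = scale ?m (Y i)"
    using arg_cong[OF Y0, of \<phi>] by (simp add: automorphism_simps[OF \<phi>(1)] \<phi>(2))
  moreover have "(\<Sum>j\<in>UNIV. Y (j + i)) = (\<Sum>j\<in>UNIV. Y j)"
    by (rule sum.reindex_bij_witness[of _ "\<lambda>j. j - i" "\<lambda>j. j + i"]) auto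
  ultimately have "scale ?m (Y i) = scale ?m (Y 0)" using Y0 by metis
  moreover have "?m \<noteq> 0" using fin by simp
  ultimately have Y: "Y i = Y 0" by (simp only: scale_cancel_left) blast
  \<comment> \<open>The square of \<open>Y i\<close> remembers \<open>Z i\<close>.\<close>
  have "mult (Y i) (Y i) = mult (Y 0) (Y 0)" by (simp add: Y)
  then have "scale (3/8) (Z i) = scale (3/8) (Z 0)" unfolding products by simp
  then show ?thesis unfolding x_eq[of i] x_eq[of 0] using Y by simp
qed

end

section \<open>Exclusion of 3C and 5A\<close>

context comm_algebra
begin

lemma orbit_2A_intro:
  fixes x :: "'m::comm_ring_1 \<Rightarrow> 'v" and p q r :: 'v
  defines "\<rho> \<equiv> miyamoto q \<circ> miyamoto p"
  assumes axes: "monster_axis r" "monster_axis p" "monster_axis q"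
    and even: "\<And>v. v \<in> even_part r"
    and fixed: "miyamoto p r = r" "miyamoto q r = r"
    and type: "has_type r p D2A"
    and orbit: "\<And>k. (\<rho> ^^ k) p = x (of_nat (2 * k))"
    and odd_order: "\<And>i :: 'm. \<exists>k. i = of_nat (2 * k)"
  shows "orbit_2A scale mult r x \<rho>"
proof -
  have p: "p = x 0" using orbit[of 0] by simp
  note moves = dihedral_orbit[OF axes(2,3), folded \<rho>_def, OF orbit odd_order]
  show ?thesis
  proof unfold_locales
    show "monster_axis r" by (rule axes)
    show "v \<in> even_part r" for v by (rule even)
    show "monster_axis (x 0)" using axes(2) p by simp
    show "miyamoto (x 0) r = r" using fixed(1) p by simp
    show "miyamoto (x 0) (x i) = x (- i)" for i using moves(2) p by simp
    show "automorphism \<rho>" unfolding \<rho>_def by (intro automorphism_comp automorphism_miyamoto axes)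
    show "\<rho> r = r" by (simp add: \<rho>_def fixed)
    show "\<rho> (x i) = x (i + 2)" for i by (rule moves(1))
    show "\<exists>k. (i :: 'm) = of_nat (2 * k)" for i by (rule odd_order)
    show "\<exists>t. mult r (x 0) = scale (1/8) (r + x 0 - t) \<and> mult r t = scale (1/8) (r + t - x 0) \<and>
        mult (x 0) t = scale (1/8) (x 0 + t - r) \<and> mult t t = t"
      by (rule product_2A[OF type axes(1,2)]) (use p in blast)
  qed
qed

lemma not_3C:
  assumes axes: "monster_axis r" "monster_axis p" "monster_axis q"
    and even: "\<And>v. v \<in> even_part r"
    and fixed: "miyamoto p r = r" "miyamoto q r = r"
    and type: "has_type r p D2A"
  shows "\<not> has_type p q D3C"
proof
  assume "has_type p q D3C"
  then have iso: "dihedral_iso table_3C of_nat p q" by simp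
  obtain g :: "'f ^ 3 \<Rightarrow> 'v" where
    g: "Vector_Spaces.linear (*s) scale g" "inj g"
      "\<And>i j. mult (g (basis_vec i)) (g (basis_vec j)) = g (table_3C i j)"
      "\<And>k. ((miyamoto q \<circ> miyamoto p) ^^ k) p = g (basis_vec (of_nat (2 * k)))"
    by (rule dihedral_model[OF iso axes(2,3)]) (rule that, assumption+)
  interpret g: Vector_Spaces.linear "(*s)" scale g by (rule g)
  define x where "x = (\<lambda>i. g (basis_vec i))"
  interpret orbit_2A scale mult r x "miyamoto q \<circ> miyamoto p"
    by (rule orbit_2A_intro[OF axes even fixed type _ two_generates_3]) (simp add: x_def g(4))
  have prods: "mult (x 0) (x 0) = x 0" "mult (x 0) (x 1) = scale (1/64) (x 0 + x 1 - x 2)"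
    "mult (x 0) (x 2) = scale (1/64) (x 0 + x 2 - x 1)"
    by (simp_all add: x_def g(3) table_3C_def next_3C_def numerals_mod_3 g.add g.diff g.scale add.commute)
  \<comment> \<open>In 3C, \<open>x\<^sub>1 + x\<^sub>2 - (1/32) x\<^sub>0\<close> is annihilated by \<open>x\<^sub>0\<close>.\<close>
  have "mult (x 0) ((\<Sum>j\<in>UNIV. x j) - scale (33/32) (x 0)) = 0"
    unfolding UNIV_mod_3
    by (rule eq_by_functionals, simp add: functional_simps mult_linear prods) (simp add: field_simps)
  from orbit_collapses[OF _ this, of 1] have "x 1 = x 0" by simp
  then have "(basis_vec 1 :: 'f ^ 3) = basis_vec 0" using g(2) by (simp add: x_def inj_eq)
  then show False by (simp add: axis_eq_axis)
qed

lemma not_5A: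
  assumes axes: "monster_axis r" "monster_axis p" "monster_axis q"
    and even: "\<And>v. v \<in> even_part r"
    and fixed: "miyamoto p r = r" "miyamoto q r = r"
    and type: "has_type r p D2A"
  shows "\<not> has_type p q D5A"
proof
  assume "has_type p q D5A"
  then have iso: "dihedral_iso table_5A (\<lambda>n. Some (of_nat n)) p q" by simp
  obtain g :: "'f ^ 5 option \<Rightarrow> 'v" where
    g: "Vector_Spaces.linear (*s) scale g" "inj g"
      "\<And>i j. mult (g (basis_vec i)) (g (basis_vec j)) = g (table_5A i j)"
      "\<And>k. ((miyamoto q \<circ> miyamoto p) ^^ k) p = g (basis_vec (Some (of_nat (2 * k))))"
    by (rule dihedral_model[OF iso axes(2,3)]) (rule that, assumption+)
  interpret g: Vector_Spaces.linear "(*s)" scale g by (rule g)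
  define x where "x = (\<lambda>i. g (basis_vec (Some i)))"
  define w where "w = g (basis_vec None)"
  interpret orbit_2A scale mult r x "miyamoto q \<circ> miyamoto p"
    by (rule orbit_2A_intro[OF axes even fixed type _ two_generates_5]) (simp add: x_def g(4))
  have prods: "mult (x 0) (x 0) = x 0"
    "mult (x 0) (x 1) = scale (1/128) (scale 3 (x 0) + scale 3 (x 1) - x 2 - x 4 - x 3) + w"
    "mult (x 0) (x 4) = scale (1/128) (scale 3 (x 4) + scale 3 (x 0) - x 1 - x 3 - x 2) + w"
    "mult (x 0) (x 2) = scale (1/128) (scale 3 (x 0) + scale 3 (x 2) - x 1 - x 4 - x 3) - w"
    "mult (x 0) (x 3) = scale (1/128) (scale 3 (x 3) + scale 3 (x 0) - x 4 - x 2 - x 1) - w"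
    by (simp_all add: x_def w_def g(3) next_5A_def next2_5A_def numerals_mod_5 g.add g.diff g.scale)
  \<comment> \<open>The multiples of \<open>w\<close> cancel: \<open>x\<^sub>1 + x\<^sub>2 + x\<^sub>3 + x\<^sub>4 - (3/32) x\<^sub>0\<close> is annihilated by \<open>x\<^sub>0\<close>.\<close>
  have "mult (x 0) ((\<Sum>j\<in>UNIV. x j) - scale (35/32) (x 0)) = 0"
    unfolding UNIV_5
    by (rule eq_by_functionals, simp add: functional_simps mult_linear prods) (simp add: field_simps)
  from orbit_collapses[OF _ this, of 1] have "x 1 = x 0" by simp
  then have "(basis_vec (Some 1) :: 'f ^ 5 option) = basis_vec (Some 0)" using g(2) by (simp add: x_def inj_eq)
  then show False by (simp add: axis_eq_axis)
qed

end

section \<open>The products in the 3A case\<close>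

locale orbit_3A = orbit_2A scale mult a x \<rho>
  for scale :: "'f::field_char_0 \<Rightarrow> 'v::ab_group_add \<Rightarrow> 'v" and mult :: "'v \<Rightarrow> 'v \<Rightarrow> 'v" and a :: 'v
    and x :: "3 \<Rightarrow> 'v" and \<rho> :: "'v \<Rightarrow> 'v" +
  fixes u :: 'v
  assumes x_times_x: "mult (x i) (x (i + 1)) =
      scale (1/32) (scale 2 (x i) + scale 2 (x (i + 1)) + x (i - 1)) - scale (135/2048) u"
    and x_times_u: "mult (x i) u = scale (1/9) (scale 2 (x i) - x (i + 1) - x (i - 1)) + scale (5/32) u"
    and u_times_u: "mult u u = u"
begin

text \<open>The common value of \<open>Y\<^sub>i Y\<^sub>j\<close> for \<open>i \<noteq> j\<close>.\<close>

definition s :: 'v where "s = mult (Y 0) (Y 1)"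

text \<open>All products \<open>Z\<^sub>i Y\<^sub>j\<close> with \<open>i \<noteq> j\<close> coincide, and likewise for \<open>Y\<^sub>i Y\<^sub>j\<close>: for three indices,
  reflections and the symmetry in \<open>i\<close> and \<open>j\<close> connect all pairs of distinct indices.\<close>

lemma Z_times_Y:
  "mult (Z 0) (Y 2) = mult (Z 0) (Y 1)" "mult (Z 1) (Y 0) = mult (Z 0) (Y 1)" "mult (Z 1) (Y 2) = mult (Z 0) (Y 1)"
  "mult (Z 2) (Y 0) = mult (Z 0) (Y 1)" "mult (Z 2) (Y 1) = mult (Z 0) (Y 1)"
  "mult (Y 0) (Z 2) = mult (Z 0) (Y 1)" "mult (Y 1) (Z 0) = mult (Z 0) (Y 1)" "mult (Y 1) (Z 2) = mult (Z 0) (Y 1)"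
  "mult (Y 2) (Z 0) = mult (Z 0) (Y 1)" "mult (Y 2) (Z 1) = mult (Z 0) (Y 1)" "mult (Y 0) (Z 1) = mult (Z 0) (Y 1)"
proof -
  have sym: "mult (Z i) (Y j) = mult (Z j) (Y i)" "mult (Y i) (Z j) = mult (Z i) (Y j)" for i j
    using Z_times_Y_commute[of i j] by (simp_all add: mult_commute)
  have 0: "mult (Z 0) (Y 2) = mult (Z 0) (Y 1)" "mult (Z 2) (Y 1) = mult (Z 2) (Y 0)"
    using reflected_products(4)[of 0 1] reflected_products(4)[of 2 1]
    by (simp_all add: numerals_mod_3)
  then show "mult (Z 0) (Y 2) = mult (Z 0) (Y 1)" "mult (Z 1) (Y 0) = mult (Z 0) (Y 1)" "mult (Z 1) (Y 2) = mult (Z 0) (Y 1)"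
  "mult (Z 2) (Y 0) = mult (Z 0) (Y 1)" "mult (Z 2) (Y 1) = mult (Z 0) (Y 1)"
  "mult (Y 0) (Z 2) = mult (Z 0) (Y 1)" "mult (Y 1) (Z 0) = mult (Z 0) (Y 1)" "mult (Y 1) (Z 2) = mult (Z 0) (Y 1)"
  "mult (Y 2) (Z 0) = mult (Z 0) (Y 1)" "mult (Y 2) (Z 1) = mult (Z 0) (Y 1)" "mult (Y 0) (Z 1) = mult (Z 0) (Y 1)"
    using sym(1)[of 0 2] sym(1)[of 0 1] sym(1)[of 1 2] by (simp_all add: sym(2))
qed

lemma Y_times_Y:
  "mult (Y 0) (Y 2) = mult (Y 0) (Y 1)" "mult (Y 1) (Y 2) = mult (Y 0) (Y 1)"
  "mult (Y 1) (Y 0) = mult (Y 0) (Y 1)" "mult (Y 2) (Y 0) = mult (Y 0) (Y 1)" "mult (Y 2) (Y 1) = mult (Y 0) (Y 1)"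
  using reflected_products(3)[of 0 1] reflected_products(3)[of 2 1]
  by (simp_all add: numerals_mod_3 mult_commute)

lemma products_of_distinct_axes:
  "mult (x 0) (x 1) = scale (1/32) (scale 2 (x 0) + scale 2 (x 1) + x 2) - scale (135/2048) u"
  "mult (x 1) (x 2) = scale (1/32) (scale 2 (x 1) + scale 2 (x 2) + x 0) - scale (135/2048) u"
  "mult (x 0) (x 2) = scale (1/32) (scale 2 (x 0) + scale 2 (x 2) + x 1) - scale (135/2048) u"
proof -
  show "mult (x 0) (x 1) = scale (1/32) (scale 2 (x 0) + scale 2 (x 1) + x 2) - scale (135/2048) u"
    using x_times_x[of 0] by (simp add: numerals_mod_3)
  show "mult (x 1) (x 2) = scale (1/32) (scale 2 (x 1) + scale 2 (x 2) + x 0) - scale (135/2048) u"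
    using x_times_x[of 1] by (simp add: numerals_mod_3)
  show "mult (x 0) (x 2) = scale (1/32) (scale 2 (x 0) + scale 2 (x 2) + x 1) - scale (135/2048) u"
    using x_times_x[of 2] by (simp add: numerals_mod_3 mult_commute[of "x 2"] add.commute)
qed

text \<open>The symmetric and skew parts of the products of two distinct axes. The last claim holds because \<open>a\<close>
  annihilates \<open>Z\<^sub>0 Z\<^sub>1\<close>.\<close>

lemma peirce_products:
  assumes u: "u = scale \<mu> a + u0 + U" and u0: "mult a u0 = 0" and U: "skew U"
  shows "mult (Z 0) (Y 1) = scale (1/64) (Y 0 + Y 1 + Y 2) - scale (135/4096) U"
    "mult (Z 0) (Z 1) = scale (1/256 - 135/2048 * \<mu>) a - s + scale (1/16) (Z 0 + Z 1) + scale (1/32) (Z 2)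
       - scale (135/2048) u0"
    "mult (Z 1) (Z 2) = scale (1/256 - 135/2048 * \<mu>) a - s + scale (1/16) (Z 1 + Z 2) + scale (1/32) (Z 0)
       - scale (135/2048) u0"
    "mult (Z 0) (Z 2) = scale (1/256 - 135/2048 * \<mu>) a - s + scale (1/16) (Z 0 + Z 2) + scale (1/32) (Z 1)
       - scale (135/2048) u0"
    "mult a s = scale (1/256 - 135/2048 * \<mu>) a"
proof -
  note rules = functional_simps mult_linear products aa Z_times_Y Y_times_Y
  have main: "mult (Z i) (Z j) - (scale (1/256 - 135/2048 * \<mu>) a - s + scale (1/16) (Z i + Z j) + scale (1/32) (Z k)
       - scale (135/2048) u0) = 0 \<and> scale 2 (mult (Z 0) (Y 1)) - (scale (1/32) (Y i + Y j + Y k) - scale (135/2048) U) = 0"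
    if "mult (x i) (x j) = scale (1/32) (scale 2 (x i) + scale 2 (x j) + x k) - scale (135/2048) u"
      "mult (Z i) (Y j) = mult (Z 0) (Y 1)" "mult (Y i) (Z j) = mult (Z 0) (Y 1)"
      "mult (Y i) (Y j) = mult (Y 0) (Y 1)" for i j k
  proof -
    have "(mult (Z i) (Z j) - (scale (1/256 - 135/2048 * \<mu>) a - s + scale (1/16) (Z i + Z j) + scale (1/32) (Z k)
       - scale (135/2048) u0)) + (scale 2 (mult (Z 0) (Y 1)) - (scale (1/32) (Y i + Y j + Y k) - scale (135/2048) U))
       = mult (x i) (x j) - (scale (1/32) (scale 2 (x i) + scale 2 (x j) + x k) - scale (135/2048) u)"
      unfolding x_eq[of i] x_eq[of j] x_eq[of k] u s_def
      by (rule eq_by_functionals, simp add: rules that) (simp add: field_simps)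
    then have 0: "(mult (Z i) (Z j) - (scale (1/256 - 135/2048 * \<mu>) a - s + scale (1/16) (Z i + Z j) + scale (1/32) (Z k)
       - scale (135/2048) u0)) + (scale 2 (mult (Z 0) (Y 1)) - (scale (1/32) (Y i + Y j + Y k) - scale (135/2048) U)) = 0"
      unfolding that(1) by simp
    have sym: "symm (mult (Z i) (Z j) - (scale (1/256 - 135/2048 * \<mu>) a - s + scale (1/16) (Z i + Z j) + scale (1/32) (Z k)
       - scale (135/2048) u0))" "skew (scale 2 (mult (Z 0) (Y 1)) - (scale (1/32) (Y i + Y j + Y k) - scale (135/2048) U))"
      unfolding s_def using symm_if_annihilated[OF u0] U by (blast intro: parities)+
    show ?thesis using parity_zero[OF 0 sym] by blast
  qed
  note m = main[OF products_of_distinct_axes(1)] main[OF products_of_distinct_axes(2)] main[OF products_of_distinct_axes(3)]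
  show "mult (Z 0) (Y 1) = scale (1/64) (Y 0 + Y 1 + Y 2) - scale (135/4096) U"
    by (rule eq_by_combination[OF m(1)[THEN conjunct2], of _ _ "1/2"])
      (simp_all add: Z_times_Y scale_right_diff_distrib)
  show zz: "mult (Z 0) (Z 1) = scale (1/256 - 135/2048 * \<mu>) a - s + scale (1/16) (Z 0 + Z 1) + scale (1/32) (Z 2)
       - scale (135/2048) u0"
    "mult (Z 1) (Z 2) = scale (1/256 - 135/2048 * \<mu>) a - s + scale (1/16) (Z 1 + Z 2) + scale (1/32) (Z 0)
       - scale (135/2048) u0"
    "mult (Z 0) (Z 2) = scale (1/256 - 135/2048 * \<mu>) a - s + scale (1/16) (Z 0 + Z 2) + scale (1/32) (Z 1)
       - scale (135/2048) u0"
    using m[THEN conjunct1] by (simp_all add: Z_times_Y Y_times_Y)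
  have "mult a (mult (Z 0) (Z 1)) = 0" by (rule zero_products) (simp_all add: products)
  then have "scale (1/256 - 135/2048 * \<mu>) a - mult a s = 0"
    unfolding zz(1) by (simp add: mult_linear products aa u0)
  then show "mult a s = scale (1/256 - 135/2048 * \<mu>) a" by simp
qed

text \<open>The difference of the \<open>0\<close>-eigenvector \<open>n\<close> and the \<open>1/4\<close>-eigenvector \<open>u - (8/45) x\<^sub>0 - (32/45) (x\<^sub>1 + x\<^sub>2)\<close> of
  \<open>x\<^sub>0\<close>: the unknown \<open>u\<close> cancels.\<close>

definition m :: 'v where "m = scale (256/135) (x 1 + x 2) - scale (26/135) (x 0)"

definition n :: 'v where "n = u - scale (10/27) (x 0) + scale (32/27) (x 1 + x 2)"

text \<open>The resurrection principle. The vectors \<open>n\<close> and \<open>n - m\<close> are eigenvectors of \<open>x\<^sub>0\<close> for \<open>0\<close> and \<open>1/4\<close>, and their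
  difference \<open>m\<close> lies in the span of the axes. Combining the fusion rules for both expresses the unknown
  product \<open>Y\<^sub>0 n\<close>, and so \<open>Y\<^sub>0 u\<close>, by products of axes, \<open>n\<close> itself and a multiple of \<open>x\<^sub>0\<close>.\<close>

lemma resurrection:
  obtains \<nu> where
    "mult (Y 0) n = scale 2 (mult (x 0) (mult a m)) - scale (1/4) (mult a m) + scale (1/2) (mult (Y 0) m)
       + scale (1/16) (n - m) - scale \<nu> (x 0)"
    "- mult (x 0) (mult a m - scale 2 (mult (Y 0) m)) =
       scale (1/4) (mult a n - scale 2 (mult (Y 0) n) - mult a m + scale 2 (mult (Y 0) m))"
    "mult (x 0) (mult (Y 0) n) = scale (1/8) (mult (Y 0) n) + scale (1/16) (mult a n)"
proof -
  have xx: "mult (x 0) (x 0) = x 0" using axis_x by (simp add: monster_axis_def)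
  have xu: "mult (x 0) u = scale (1/9) (scale 2 (x 0) - x 1 - x 2) + scale (5/32) u"
    using x_times_u[of 0] by (simp add: numerals_mod_3)
  note rules = functional_simps mult_linear products_of_distinct_axes xx xu
  have n: "mult (x 0) n = 0"
    unfolding n_def by (rule eq_by_functionals, simp add: rules) (simp add: field_simps)
  have w: "mult (x 0) (n - m) = scale (1/4) (n - m)"
    unfolding n_def m_def by (rule eq_by_functionals, simp add: rules) (simp add: field_simps)
  note eq = zero_eigenvector_products[OF n]
  obtain \<nu> where \<nu>:
    "mult (x 0) (mult a (n - m) - scale 2 (mult (Y 0) (n - m))) =
      scale (1/4) (mult a (n - m) - scale 2 (mult (Y 0) (n - m)))"
    "mult (x 0) (mult a (n - m) + scale 2 (mult (Y 0) (n - m))) = scale (1/16) (n - m) - scale \<nu> (x 0)"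
    by (rule quarter_eigenvector_products[OF w])
  show ?thesis
  proof (rule that[of \<nu>])
    show "mult (Y 0) n = scale 2 (mult (x 0) (mult a m)) - scale (1/4) (mult a m) + scale (1/2) (mult (Y 0) m)
       + scale (1/16) (n - m) - scale \<nu> (x 0)"
      by (rule eq_by_combination3[OF \<nu> eq(1), of _ _ 1 1 "-2"], rule eq_by_functionals,
          simp add: functional_simps mult_linear) (simp add: field_simps)
    show "- mult (x 0) (mult a m - scale 2 (mult (Y 0) m)) =
       scale (1/4) (mult a n - scale 2 (mult (Y 0) n) - mult a m + scale 2 (mult (Y 0) m))"
      by (rule eq_by_combination3[OF \<nu>(1) eq, of _ _ 1 "-1" 2], rule eq_by_functionals)
        (simp add: functional_simps mult_linear)
    show "mult (x 0) (mult (Y 0) n) = scale (1/8) (mult (Y 0) n) + scale (1/16) (mult a n)" by (rule eq)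
  qed
qed

text \<open>Write \<open>u = \<mu> a + u0 + U\<close> according to the eigenvalues of \<open>a\<close>. The identities of \<open>resurrection\<close>,
  split by parity, give in turn \<open>\<mu> = 0\<close>, the scalar \<open>\<nu>\<close>, the products of \<open>x\<^sub>0\<close> with all the components, and
  finally \<open>U = 0\<close>.\<close>

lemma u_annihilated:
  shows "mult a u = 0"
    and "s = scale (1/256) a + scale (1/32) (Z 0 + Z 1 + Z 2) - scale (45/1024) u"
proof -
  obtain \<mu> u0 U where u: "u = scale \<mu> a + u0 + U" "mult a u0 = 0" "skew U"
    by (rule peirce_decomposition[of u])
  have U: "mult a U = scale (1/4) U" using u(3) by (simp add: skew_def)
  note pp = peirce_products[OF u]
  have su: "symm u0" by (rule symm_if_annihilated[OF u(2)])
  have ss: "symm s" unfolding s_def by (blast intro: parities)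
  note sp = su ss u(3) parities
  \<comment> \<open>Only the component of \<open>s\<close> along \<open>a\<close> is known at this stage; it suffices to see that \<open>a\<close> annihilates
    \<open>Z\<^sub>0 s\<close>.\<close>
  obtain s0 where s0: "s = scale (1/256 - 135/2048 * \<mu>) a + s0" "mult a s0 = 0"
  proof -
    have "mult a (s - scale (1/256 - 135/2048 * \<mu>) a) = 0" by (simp add: mult_linear pp(5) aa)
    then show ?thesis using that[of "s - scale (1/256 - 135/2048 * \<mu>) a"] by simp
  qed
  have "mult (Z 0) s = mult (Z 0) s0" unfolding s0(1) by (simp add: mult_linear products)
  then have aZs: "mult a (mult (Z 0) s) = 0" using zero_products(1)[OF products(4) s0(2)] by simp
  have aZu: "mult a (mult (Z 0) u0) = 0" using zero_products(1)[OF products(4) u(2)] by simp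
  note rules = functional_simps mult_linear products aa Z_times_Y Y_times_Y s_def[symmetric] pp u(2) U
    mult_commute[of u0 a] mult_commute[of U a] mult_commute[of s a]

  \<comment> \<open>The known product \<open>x\<^sub>0 u\<close>, split by parity.\<close>
  have "(mult (Y 0) U + mult (Z 0) u0 - scale (1/9) (scale 2 (Z 0) - Z 1 - Z 2) - scale (5/32) u0
        - scale (1/32 * \<mu>) a)
     + (mult (Z 0) U + mult (Y 0) u0 - scale (1/9) (scale 2 (Y 0) - Y 1 - Y 2) - scale (1/8) U
        + scale (1/4 * \<mu>) (Y 0))
     = mult (x 0) u - (scale (1/9) (scale 2 (x 0) - x 1 - x 2) + scale (5/32) u)"
    unfolding u(1) x_eq[of 0] x_eq[of 1] x_eq[of 2]
    by (rule eq_by_functionals, simp add: rules) (simp add: field_simps)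
  also have "\<dots> = 0" using x_times_u[of 0] by (simp add: numerals_mod_3)
  finally have xu: "(mult (Y 0) U + mult (Z 0) u0 - scale (1/9) (scale 2 (Z 0) - Z 1 - Z 2) - scale (5/32) u0
        - scale (1/32 * \<mu>) a)
     + (mult (Z 0) U + mult (Y 0) u0 - scale (1/9) (scale 2 (Y 0) - Y 1 - Y 2) - scale (1/8) U
        + scale (1/4 * \<mu>) (Y 0)) = 0" .
  have xu0: "mult (Y 0) U + mult (Z 0) u0 - scale (1/9) (scale 2 (Z 0) - Z 1 - Z 2) - scale (5/32) u0
        - scale (1/32 * \<mu>) a = 0"
    by (rule parity_zero(1)[OF xu]; blast intro: sp)
  have xu1: "mult (Z 0) U + mult (Y 0) u0 - scale (1/9) (scale 2 (Y 0) - Y 1 - Y 2) - scale (1/8) U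
        + scale (1/4 * \<mu>) (Y 0) = 0"
    by (rule parity_zero(2)[OF xu]; blast intro: sp)
  from arg_cong[OF xu0, of "mult a"] have aYU: "mult a (mult (Y 0) U) = scale (1/32 * \<mu>) a"
    by (simp add: mult_linear products u(2) aa aZu)

  obtain \<nu> where r: "mult (Y 0) n = scale 2 (mult (x 0) (mult a m)) - scale (1/4) (mult a m) + scale (1/2) (mult (Y 0) m)
       + scale (1/16) (n - m) - scale \<nu> (x 0)"
    "- mult (x 0) (mult a m - scale 2 (mult (Y 0) m)) =
       scale (1/4) (mult a n - scale 2 (mult (Y 0) n) - mult a m + scale 2 (mult (Y 0) m))"
    "mult (x 0) (mult (Y 0) n) = scale (1/8) (mult (Y 0) n) + scale (1/16) (mult a n)"
    by (rule resurrection)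

  \<comment> \<open>The second identity of \<open>resurrection\<close>. Its symmetric part has \<open>a\<close>-component \<open>-(27/128) \<mu>\<close>, so \<open>\<mu> = 0\<close>.\<close>
  have "(scale (1/4) (mult (Y 0) U) + scale (1024/135) (mult (Z 0) s) - scale (2/45) (Z 0)
        + scale (1/180 - 5/16 * \<mu>) a - scale (64/45) s)
     + (scale (1/2) (mult (Y 0) u0) - scale (1/4) (mult (Z 0) U) + scale (1024/135) (mult (Y 0) s)
        - scale (3/128) U + scale (1/8 * \<mu> - 22/135) (Y 0) + scale (1/90) (Y 1 + Y 2))
     = - mult (x 0) (mult a m - scale 2 (mult (Y 0) m)) -
       scale (1/4) (mult a n - scale 2 (mult (Y 0) n) - mult a m + scale 2 (mult (Y 0) m))"
    unfolding m_def n_def unfolding u(1) x_eq[of 0] x_eq[of 1] x_eq[of 2]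
    by (rule eq_by_functionals, simp add: rules) (simp add: field_simps)
  also have "\<dots> = 0" unfolding r(2) by simp
  finally have W: "(scale (1/4) (mult (Y 0) U) + scale (1024/135) (mult (Z 0) s) - scale (2/45) (Z 0)
        + scale (1/180 - 5/16 * \<mu>) a - scale (64/45) s)
     + (scale (1/2) (mult (Y 0) u0) - scale (1/4) (mult (Z 0) U) + scale (1024/135) (mult (Y 0) s)
        - scale (3/128) U + scale (1/8 * \<mu> - 22/135) (Y 0) + scale (1/90) (Y 1 + Y 2)) = 0" .
  have W0: "scale (1/4) (mult (Y 0) U) + scale (1024/135) (mult (Z 0) s) - scale (2/45) (Z 0)
        + scale (1/180 - 5/16 * \<mu>) a - scale (64/45) s = 0"
    by (rule parity_zero(1)[OF W]; blast intro: sp)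
  have W1: "scale (1/2) (mult (Y 0) u0) - scale (1/4) (mult (Z 0) U) + scale (1024/135) (mult (Y 0) s)
        - scale (3/128) U + scale (1/8 * \<mu> - 22/135) (Y 0) + scale (1/90) (Y 1 + Y 2) = 0"
    by (rule parity_zero(2)[OF W]; blast intro: sp)
  have "scale (- 27/128 * \<mu>) a = mult a (scale (1/4) (mult (Y 0) U) + scale (1024/135) (mult (Z 0) s) - scale (2/45) (Z 0)
        + scale (1/180 - 5/16 * \<mu>) a - scale (64/45) s)"
    by (rule eq_by_functionals, simp add: rules aYU aZs) (simp add: field_simps)
  then have "\<mu> = 0" unfolding W0 using a_nonzero by simp

  \<comment> \<open>The first identity. Its \<open>a\<close>-component determines \<open>\<nu>\<close>; the two parities then give \<open>Y\<^sub>0 U\<close> and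
    \<open>Y\<^sub>0 u0\<close>.\<close>
  have "(mult (Y 0) U + scale (\<nu> - 1/18) (Z 0) + scale (2/45) (Z 1 + Z 2)
        + scale (1/8 * \<nu> - 1/144) a - scale (64/45) s - scale (1/16) u0)
     + (mult (Y 0) u0 - scale (1/64) U + scale (\<nu> - 29/90) (Y 0) + scale (1/9) (Y 1 + Y 2))
     = mult (Y 0) n - (scale 2 (mult (x 0) (mult a m)) - scale (1/4) (mult a m) + scale (1/2) (mult (Y 0) m)
       + scale (1/16) (n - m) - scale \<nu> (x 0))"
    unfolding m_def n_def unfolding u(1) x_eq[of 0] x_eq[of 1] x_eq[of 2]
    by (rule eq_by_functionals, simp add: rules \<open>\<mu> = 0\<close>) (simp add: field_simps)
  also have "\<dots> = 0" unfolding r(1) by simp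
  finally have S: "(mult (Y 0) U + scale (\<nu> - 1/18) (Z 0) + scale (2/45) (Z 1 + Z 2)
        + scale (1/8 * \<nu> - 1/144) a - scale (64/45) s - scale (1/16) u0)
     + (mult (Y 0) u0 - scale (1/64) U + scale (\<nu> - 29/90) (Y 0) + scale (1/9) (Y 1 + Y 2)) = 0" .
  have S0: "mult (Y 0) U + scale (\<nu> - 1/18) (Z 0) + scale (2/45) (Z 1 + Z 2)
        + scale (1/8 * \<nu> - 1/144) a - scale (64/45) s - scale (1/16) u0 = 0"
    by (rule parity_zero(1)[OF S]; blast intro: sp)
  have S1: "mult (Y 0) u0 - scale (1/64) U + scale (\<nu> - 29/90) (Y 0) + scale (1/9) (Y 1 + Y 2) = 0"
    by (rule parity_zero(2)[OF S]; blast intro: sp)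
  have "scale (1/8 * (\<nu> - 1/10)) a = mult a (mult (Y 0) U + scale (\<nu> - 1/18) (Z 0) + scale (2/45) (Z 1 + Z 2)
        + scale (1/8 * \<nu> - 1/144) a - scale (64/45) s - scale (1/16) u0)"
    by (rule eq_by_functionals, simp add: rules aYU \<open>\<mu> = 0\<close>) (simp add: field_simps)
  then have "\<nu> = 1/10" unfolding S0 using a_nonzero by simp

  \<comment> \<open>These products determine the skew part of the third identity.\<close>
  have YU: "mult (Y 0) U = scale (64/45) s + scale (1/16) u0 - scale (2/45) (Z 0 + Z 1 + Z 2) - scale (1/180) a"
    by (rule eq_by_combination[OF S0, of _ _ 1], rule eq_by_functionals)
      (simp add: functional_simps \<open>\<nu> = 1/10\<close> field_simps)
  have Yu: "mult (Y 0) u0 = scale (1/64) U + scale (2/9) (Y 0) - scale (1/9) (Y 1 + Y 2)"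
    by (rule eq_by_combination[OF S1, of _ _ 1], rule eq_by_functionals)
      (simp add: functional_simps \<open>\<nu> = 1/10\<close> field_simps)
  have ZU: "mult (Z 0) U = scale (7/64) U"
    by (rule eq_by_combination[OF xu1, of _ _ 1], rule eq_by_functionals)
      (simp add: functional_simps Yu \<open>\<mu> = 0\<close> field_simps)
  have Ys: "mult (Y 0) s = scale (135/1024) (scale (11/256) U + scale (1/135) (Y 0) + scale (2/45) (Y 0 + Y 1 + Y 2))"
    by (rule eq_by_combination[OF W1, of _ _ "135/1024"], rule eq_by_functionals)
      (simp add: functional_simps Yu ZU \<open>\<mu> = 0\<close> field_simps)

  \<comment> \<open>The third identity: everything skew in it cancels except a non-zero multiple of \<open>U\<close>.\<close>
  let ?E = "scale (512/135) s + scale (1/16) u0 - scale (11/60) (Z 0) - scale (2/45) (Z 1 + Z 2) - scale (199/4320) a"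
  let ?O = "scale (4/27) (Y 0) - scale (2/27) (Y 1 + Y 2) - scale (1/16) U"
  have Yn: "mult (Y 0) n = ?E + ?O"
    unfolding n_def unfolding u(1) x_eq[of 0] x_eq[of 1] x_eq[of 2]
    by (rule eq_by_functionals, simp add: rules \<open>\<mu> = 0\<close> YU Yu) (simp add: field_simps)
  have an: "mult a n = scale (1/4) a + (scale (1/4) U - scale (5/54) (Y 0) + scale (8/27) (Y 1 + Y 2))"
    unfolding n_def unfolding u(1) x_eq[of 0] x_eq[of 1] x_eq[of 2]
    by (rule eq_by_functionals, simp add: rules \<open>\<mu> = 0\<close>) (simp add: field_simps)
  have "(mult (scale (1/8) a + Z 0) ?E + mult (Y 0) ?O - scale (1/8) ?E - scale (1/64) a) + scale (7/512) U
     = mult (x 0) (mult (Y 0) n) - (scale (1/8) (mult (Y 0) n) + scale (1/16) (mult a n))"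
    unfolding Yn an x_eq[of 0]
    by (rule eq_by_functionals, simp add: rules \<open>\<mu> = 0\<close> YU Yu ZU Ys) (simp add: field_simps)
  also have "\<dots> = 0" unfolding r(3) by simp
  finally have E: "(mult (scale (1/8) a + Z 0) ?E + mult (Y 0) ?O - scale (1/8) ?E - scale (1/64) a)
      + scale (7/512) U = 0" .
  have "scale (7/512) U = 0"
    by (rule parity_zero(2)[OF E]; blast intro: sp)
  then have "U = 0" by simp
  then have u0: "u0 = u" using u(1) \<open>\<mu> = 0\<close> by simp
  then show "mult a u = 0" using u(2) by simp
  \<comment> \<open>With \<open>U = 0\<close> the formula for \<open>Y\<^sub>0 U\<close> becomes one for \<open>s\<close>.\<close>
  show "s = scale (1/256) a + scale (1/32) (Z 0 + Z 1 + Z 2) - scale (45/1024) u"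
    by (rule eq_by_combination[OF YU, of _ _ "- 45/64"], rule eq_by_functionals)
      (simp add: functional_simps \<open>U = 0\<close> u0 field_simps)
qed

text \<open>With \<open>\<mu> = 0\<close> and \<open>U = 0\<close> all products of \<open>a\<close>, \<open>u\<close>, \<open>Z\<^sub>i\<close> and \<open>Y\<^sub>i\<close> lie in their span.\<close>

lemma product_table:
  "mult a u = 0" "mult u a = 0" "mult u u = u"
  "mult (Z 0) (Y 1) = scale (1/64) (Y 0 + Y 1 + Y 2)"
  "mult (Y 0) (Y 1) = scale (1/256) a + scale (1/32) (Z 0 + Z 1 + Z 2) - scale (45/1024) u"
  "mult (Z 0) (Z 1) = scale (1/32) (Z 0 + Z 1) - scale (45/2048) u"
  "mult (Z 1) (Z 0) = scale (1/32) (Z 0 + Z 1) - scale (45/2048) u"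
  "mult (Z 1) (Z 2) = scale (1/32) (Z 1 + Z 2) - scale (45/2048) u"
  "mult (Z 2) (Z 1) = scale (1/32) (Z 1 + Z 2) - scale (45/2048) u"
  "mult (Z 0) (Z 2) = scale (1/32) (Z 0 + Z 2) - scale (45/2048) u"
  "mult (Z 2) (Z 0) = scale (1/32) (Z 0 + Z 2) - scale (45/2048) u"
  "mult (Z i) u = scale (1/9) (scale 2 (Z i) - Z (i + 1) - Z (i - 1)) + scale (5/32) u"
  "mult u (Z i) = scale (1/9) (scale 2 (Z i) - Z (i + 1) - Z (i - 1)) + scale (5/32) u"
  "mult (Y i) u = scale (1/9) (scale 2 (Y i) - Y (i + 1) - Y (i - 1))"
  "mult u (Y i) = scale (1/9) (scale 2 (Y i) - Y (i + 1) - Y (i - 1))"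
proof -
  have u: "u = scale 0 a + u + 0" by simp
  note pp = peirce_products[OF u u_annihilated(1) symm_skew_linear(11)]
  show "mult a u = 0" "mult u a = 0" "mult u u = u"
    using u_annihilated(1) u_times_u by (simp_all add: mult_commute)
  show "mult (Z 0) (Y 1) = scale (1/64) (Y 0 + Y 1 + Y 2)" using pp(1) by simp
  show "mult (Y 0) (Y 1) = scale (1/256) a + scale (1/32) (Z 0 + Z 1 + Z 2) - scale (45/1024) u"
    using u_annihilated(2) by (simp add: s_def)
  show zz: "mult (Z 0) (Z 1) = scale (1/32) (Z 0 + Z 1) - scale (45/2048) u"
    "mult (Z 1) (Z 2) = scale (1/32) (Z 1 + Z 2) - scale (45/2048) u"
    "mult (Z 0) (Z 2) = scale (1/32) (Z 0 + Z 2) - scale (45/2048) u"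
    unfolding pp u_annihilated(2)
    by (rule eq_by_functionals, simp add: functional_simps, simp add: field_simps)+
  then show "mult (Z 1) (Z 0) = scale (1/32) (Z 0 + Z 1) - scale (45/2048) u"
    "mult (Z 2) (Z 1) = scale (1/32) (Z 1 + Z 2) - scale (45/2048) u"
    "mult (Z 2) (Z 0) = scale (1/32) (Z 0 + Z 2) - scale (45/2048) u"
    by (simp_all add: mult_commute)
  have "mult (Z i) u + mult (Y i) u =
      (scale (1/9) (scale 2 (Z i) - Z (i + 1) - Z (i - 1)) + scale (5/32) u) +
      scale (1/9) (scale 2 (Y i) - Y (i + 1) - Y (i - 1))"
    by (rule eq_by_combination[OF x_times_u[of i], of _ _ 1], rule eq_by_functionals,
        simp add: x_eq[of i] x_eq[of "i + 1"] x_eq[of "i - 1"] functional_simps mult_linear u_annihilated(1))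
      (simp add: field_simps)
  note * = parity[OF this]
  show "mult (Z i) u = scale (1/9) (scale 2 (Z i) - Z (i + 1) - Z (i - 1)) + scale (5/32) u"
    using symm_if_annihilated[OF u_annihilated(1)] by (intro *(1); blast intro: parities)
  moreover show "mult (Y i) u = scale (1/9) (scale 2 (Y i) - Y (i + 1) - Y (i - 1))"
    using symm_if_annihilated[OF u_annihilated(1)] by (intro *(2); blast intro: parities)
  ultimately show "mult u (Z i) = scale (1/9) (scale 2 (Z i) - Z (i + 1) - Z (i - 1)) + scale (5/32) u"
    "mult u (Y i) = scale (1/9) (scale 2 (Y i) - Y (i + 1) - Y (i - 1))"
    by (simp_all add: mult_commute)
qed

text \<open>The \<open>a\<close>-component of the product is a non-degenerate form on the span of the \<open>Y\<^sub>i\<close>, with Gram matrix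
  proportional to the one with diagonal 28 and off-diagonal entries 1.\<close>

lemma Y_independent:
  assumes "scale c0 (Y 0) + scale c1 (Y 1) + scale c2 (Y 2) = 0"
  shows "c0 = 0" "c1 = 0" "c2 = 0"
proof -
  have as: "mult a s = scale (1/256) a"
    unfolding u_annihilated(2) by (simp add: mult_linear aa products u_annihilated(1))
  have 0: "mult a (mult (Y i) (scale c0 (Y 0) + scale c1 (Y 1) + scale c2 (Y 2))) = 0" for i
    by (simp add: assms)
  note rules = functional_simps mult_linear products aa Y_times_Y s_def[symmetric] as
  have "scale (7/64 * c0 + 1/256 * (c1 + c2)) a =
      mult a (mult (Y 0) (scale c0 (Y 0) + scale c1 (Y 1) + scale c2 (Y 2)))"
    "scale (7/64 * c1 + 1/256 * (c0 + c2)) a =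
      mult a (mult (Y 1) (scale c0 (Y 0) + scale c1 (Y 1) + scale c2 (Y 2)))"
    "scale (7/64 * c2 + 1/256 * (c0 + c1)) a =
      mult a (mult (Y 2) (scale c0 (Y 0) + scale c1 (Y 1) + scale c2 (Y 2)))"
    by (rule eq_by_functionals, simp add: rules, simp add: field_simps)+
  then have 1: "7/64 * c0 + 1/256 * (c1 + c2) = 0" "7/64 * c1 + 1/256 * (c0 + c2) = 0"
    "7/64 * c2 + 1/256 * (c0 + c1) = 0" unfolding 0 using a_nonzero by simp_all
  have "28 * c0 + c1 + c2 = 256 * (7/64 * c0 + 1/256 * (c1 + c2))"
    "28 * c1 + c0 + c2 = 256 * (7/64 * c1 + 1/256 * (c0 + c2))"
    "28 * c2 + c0 + c1 = 256 * (7/64 * c2 + 1/256 * (c0 + c1))" by (simp_all add: field_simps)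
  then have *: "28 * c0 + c1 + c2 = 0" "28 * c1 + c0 + c2 = 0" "28 * c2 + c0 + c1 = 0"
    unfolding 1 by simp_all
  \<comment> \<open>The matrix with diagonal 28 and all other entries 1 has eigenvalues 27 and 30, hence an inverse.\<close>
  have "30 * (27 * c0) = 29 * (28 * c0 + c1 + c2) - (28 * c1 + c0 + c2) - (28 * c2 + c0 + c1)"
    "30 * (27 * c1) = 29 * (28 * c1 + c0 + c2) - (28 * c0 + c1 + c2) - (28 * c2 + c0 + c1)"
    "30 * (27 * c2) = 29 * (28 * c2 + c0 + c1) - (28 * c0 + c1 + c2) - (28 * c1 + c0 + c2)"
    by (simp_all add: algebra_simps)
  then show "c0 = 0" "c1 = 0" "c2 = 0" unfolding * by simp_all
qed

text \<open>Multiplication by \<open>Y\<^sub>i\<close> maps a relation between the \<open>Z\<^sub>j\<close> and \<open>u\<close> to one between the \<open>Y\<^sub>j\<close>.\<close>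

lemma Z_u_independent:
  assumes "scale b0 (Z 0) + scale b1 (Z 1) + scale b2 (Z 2) + scale d u = 0"
  shows "b0 = 0" "b1 = 0" "b2 = 0" "d = 0"
proof -
  have 0: "mult (Y i) (scale b0 (Z 0) + scale b1 (Z 1) + scale b2 (Z 2) + scale d u) = 0" for i
    by (simp add: assms)
  note rules = functional_simps mult_linear products Z_times_Y product_table numerals_mod_3
  have "scale (15/32 * b0 + 1/64 * (b1 + b2) + 2/9 * d) (Y 0) + scale (1/64 * (b1 + b2) - 1/9 * d) (Y 1)
      + scale (1/64 * (b1 + b2) - 1/9 * d) (Y 2) =
      mult (Y 0) (scale b0 (Z 0) + scale b1 (Z 1) + scale b2 (Z 2) + scale d u)"
    by (rule eq_by_functionals, simp add: rules) (simp add: field_simps)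
  from Y_independent[OF this[unfolded 0]]
  have A: "15/32 * b0 + 1/64 * (b1 + b2) + 2/9 * d = 0" "1/64 * (b1 + b2) - 1/9 * d = 0" by simp_all
  have "scale (1/64 * (b0 + b2) - 1/9 * d) (Y 0) + scale (15/32 * b1 + 1/64 * (b0 + b2) + 2/9 * d) (Y 1)
      + scale (1/64 * (b0 + b2) - 1/9 * d) (Y 2) =
      mult (Y 1) (scale b0 (Z 0) + scale b1 (Z 1) + scale b2 (Z 2) + scale d u)"
    by (rule eq_by_functionals, simp add: rules) (simp add: field_simps)
  from Y_independent[OF this[unfolded 0]]
  have B: "1/64 * (b0 + b2) - 1/9 * d = 0" by simp
  have "scale (1/64 * (b0 + b1) - 1/9 * d) (Y 0) + scale (1/64 * (b0 + b1) - 1/9 * d) (Y 1)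
      + scale (15/32 * b2 + 1/64 * (b0 + b1) + 2/9 * d) (Y 2) =
      mult (Y 2) (scale b0 (Z 0) + scale b1 (Z 1) + scale b2 (Z 2) + scale d u)"
    by (rule eq_by_functionals, simp add: rules) (simp add: field_simps)
  from Y_independent[OF this[unfolded 0]]
  have C: "1/64 * (b0 + b1) - 1/9 * d = 0" by simp
  have "270 * b0 + 9 * (b1 + b2) + 128 * d = 576 * (15/32 * b0 + 1/64 * (b1 + b2) + 2/9 * d)"
    "9 * (b1 + b2) - 64 * d = 576 * (1/64 * (b1 + b2) - 1/9 * d)"
    "9 * (b0 + b2) - 64 * d = 576 * (1/64 * (b0 + b2) - 1/9 * d)"
    "9 * (b0 + b1) - 64 * d = 576 * (1/64 * (b0 + b1) - 1/9 * d)"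
    by (simp_all add: field_simps)
  then have *: "270 * b0 + 9 * (b1 + b2) + 128 * d = 0" "9 * (b1 + b2) = 64 * d"
    "9 * (b0 + b2) = 64 * d" "9 * (b0 + b1) = 64 * d"
    unfolding A B C by simp_all
  have "9 * b1 = 9 * b0" "9 * b2 = 9 * b0" using *(2-4) by algebra+
  then have b: "b1 = b0" "b2 = b0" by simp_all
  have "324 * b0 = 0" using *(1,2) unfolding b by algebra
  then show "b0 = 0" by simp
  with b *(2) show "b1 = 0" "b2 = 0" "d = 0" by simp_all
qed

end

section \<open>The isomorphism with 6A\<close>

lemma numerals_mod_6: "(6 :: 6) = 0" "(7 :: 6) = 1" "(8 :: 6) = 2" "(-1 :: 6) = 5" "(-2 :: 6) = 4"
  by simp_all

lemma exhaust_6: "(i :: 6) = 0 \<or> i = 1 \<or> i = 2 \<or> i = 3 \<or> i = 4 \<or> i = 5"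
proof (cases i rule: bit0.cases)
  case (1 z)
  then have "z = 0 \<or> z = 1 \<or> z = 2 \<or> z = 3 \<or> z = 4 \<or> z = 5" by auto
  with 1(1) show ?thesis by auto
qed

lemma UNIV_basis_6A: "(UNIV :: basis_6A set) =
    {Rho6, U6, Axis6 0, Axis6 1, Axis6 2, Axis6 3, Axis6 4, Axis6 5}"
proof -
  have "b \<in> {Rho6, U6, Axis6 0, Axis6 1, Axis6 2, Axis6 3, Axis6 4, Axis6 5}" for b
    by (cases b) (use exhaust_6 in auto)
  then show ?thesis by blast
qed

context comm_algebra
begin

definition combination :: "('n::finite \<Rightarrow> 'v) \<Rightarrow> 'f ^ 'n \<Rightarrow> 'v" where
  "combination e v = (\<Sum>i\<in>UNIV. scale (v $ i) (e i))"

lemma linear_combination: "Vector_Spaces.linear (*s) scale (combination e)"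
proof -
  have "vector_space ((*s) :: 'f \<Rightarrow> 'f ^ 'n \<Rightarrow> 'f ^ 'n)" ..
  moreover have "vector_space scale" ..
  ultimately show ?thesis
    by (simp add: Vector_Spaces.linear_iff combination_def scale_left_distrib sum.distrib scale_sum_right)
qed

lemma combination_basis: "combination e (basis_vec i) = e i"
proof -
  have "combination e (basis_vec i) = (\<Sum>j\<in>UNIV. if j = i then e i else 0)"
    unfolding combination_def by (intro sum.cong refl) (simp add: axis_def)
  then show ?thesis by simp
qed

text \<open>A linear map out of a table algebra is multiplicative as soon as it is so on the basis.\<close>

lemma combination_table_mult:
  assumes table: "\<And>i j. mult (e i) (e j) = combination e (T i j)"
  shows "combination e (table_mult T v w) = mult (combination e v) (combination e w)"
proof -
  interpret g: Vector_Spaces.linear "(*s)" scale "combination e" by (rule linear_combination)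
  have sum_left: "mult (sum f S) u = (\<Sum>j\<in>S. mult (f j) u)" for f u and S :: "'n::finite set"
    using mult_sum_right[of u f S] by (simp add: mult_commute)
  have "mult (combination e v) (combination e w) =
      (\<Sum>i\<in>UNIV. \<Sum>j\<in>UNIV. scale (v $ i * w $ j) (mult (e i) (e j)))"
    unfolding combination_def sum_left unfolding mult_sum_right by (simp add: mult_linear mult.commute)
  also have "\<dots> = combination e (table_mult T v w)"
    unfolding table_mult_def by (simp add: g.sum g.scale table)
  finally show ?thesis by simp
qed

end

context orbit_3A
begin

text \<open>The axes of 6A with even index are the \<open>x j\<close>, in the order \<open>a\<^sub>0, a\<^sub>2, a\<^sub>4\<close>, and \<open>a\<^sub>i\<^sub>+\<^sub>3\<close> is the mirror
  image of \<open>a\<^sub>i\<close> under the sign change on the skew part, that is, the third axis of its 2A algebra with \<open>a\<close>.\<close>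

definition basis_image :: "basis_6A \<Rightarrow> 'v" where
  "basis_image b = (case b of Rho6 \<Rightarrow> a | U6 \<Rightarrow> u | Axis6 i \<Rightarrow>
     if i = 0 then scale (1/8) a + Z 0 + Y 0 else if i = 3 then scale (1/8) a + Z 0 - Y 0
     else if i = 2 then scale (1/8) a + Z 1 + Y 1 else if i = 5 then scale (1/8) a + Z 1 - Y 1
     else if i = 4 then scale (1/8) a + Z 2 + Y 2 else scale (1/8) a + Z 2 - Y 2)"

lemma basis_image_simps:
  "basis_image Rho6 = a" "basis_image U6 = u"
  "basis_image (Axis6 0) = scale (1/8) a + Z 0 + Y 0" "basis_image (Axis6 3) = scale (1/8) a + Z 0 - Y 0"
  "basis_image (Axis6 2) = scale (1/8) a + Z 1 + Y 1" "basis_image (Axis6 5) = scale (1/8) a + Z 1 - Y 1"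
  "basis_image (Axis6 4) = scale (1/8) a + Z 2 + Y 2" "basis_image (Axis6 1) = scale (1/8) a + Z 2 - Y 2"
  by (simp_all add: basis_image_def)

lemma basis_image_table:
  "mult (basis_image b) (basis_image c) = combination basis_image (table_6A b c)"
proof -
  interpret g: Vector_Spaces.linear "(*s)" scale "combination basis_image" by (rule linear_combination)
  note table = next_6A_def next2_6A_def next3_6A_def axis_rho_6A_def axis_u_6A_def numerals_mod_6
    g.add g.diff g.scale g.zero combination_basis basis_image_simps
  note prods = functional_simps mult_linear aa products product_table Z_times_Y Y_times_Y numerals_mod_3
  have "b \<in> {Rho6, U6, Axis6 0, Axis6 1, Axis6 2, Axis6 3, Axis6 4, Axis6 5}"
    "c \<in> {Rho6, U6, Axis6 0, Axis6 1, Axis6 2, Axis6 3, Axis6 4, Axis6 5}"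
    unfolding UNIV_basis_6A[symmetric] by simp_all
  then show ?thesis
    by (elim insertE emptyE, simp_all only: basis_image_simps, simp_all add: table)
      (rule eq_by_functionals, (simp add: prods; fail | simp add: prods, simp add: field_simps; fail))+
qed

lemma combination_basis_image:
  "combination basis_image v =
    scale (v $ Rho6 + 1/8 * (v $ Axis6 0 + v $ Axis6 1 + v $ Axis6 2 + v $ Axis6 3 + v $ Axis6 4 + v $ Axis6 5)) a
    + (scale (v $ Axis6 0 + v $ Axis6 3) (Z 0) + scale (v $ Axis6 2 + v $ Axis6 5) (Z 1)
       + scale (v $ Axis6 4 + v $ Axis6 1) (Z 2) + scale (v $ U6) u)
    + (scale (v $ Axis6 0 - v $ Axis6 3) (Y 0) + scale (v $ Axis6 2 - v $ Axis6 5) (Y 1)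
       + scale (v $ Axis6 4 - v $ Axis6 1) (Y 2))"
  unfolding combination_def UNIV_basis_6A
  by (rule eq_by_functionals) (simp add: basis_image_simps functional_simps field_simps)

lemma combination_basis_image_injective: "inj (combination basis_image)"
proof -
  interpret g: Vector_Spaces.linear "(*s)" scale "combination basis_image" by (rule linear_combination)
  have "v = 0" if "combination basis_image v = 0" for v
  proof -
    let ?r = "v $ Rho6 + 1/8 * (v $ Axis6 0 + v $ Axis6 1 + v $ Axis6 2 + v $ Axis6 3 + v $ Axis6 4 + v $ Axis6 5)"
    let ?E = "scale (v $ Axis6 0 + v $ Axis6 3) (Z 0) + scale (v $ Axis6 2 + v $ Axis6 5) (Z 1)
       + scale (v $ Axis6 4 + v $ Axis6 1) (Z 2) + scale (v $ U6) u"
    let ?O = "scale (v $ Axis6 0 - v $ Axis6 3) (Y 0) + scale (v $ Axis6 2 - v $ Axis6 5) (Y 1)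
       + scale (v $ Axis6 4 - v $ Axis6 1) (Y 2)"
    have 0: "(scale ?r a + ?E) + ?O = 0"
      using that unfolding combination_basis_image by simp
    have su: "symm u" by (rule symm_if_annihilated[OF u_annihilated(1)])
    have E: "scale ?r a + ?E = 0" and O: "?O = 0"
      by (rule parity_zero[OF 0]; use su in \<open>blast intro: parities\<close>)+
    have "mult a (scale ?r a + ?E) = scale ?r a"
      by (simp add: mult_linear aa products u_annihilated(1))
    then have r: "?r = 0" unfolding E using a_nonzero by simp
    with E have "?E = 0" by simp
    \<comment> \<open>The symmetric and the skew part give sums and differences of the
      coefficients of \<open>x\<^sub>i\<close> and its mirror image.\<close>
    note zero = Z_u_independent[OF this] Y_independent[OF O]
    have half: "p = 0 \<and> q = 0" if "p + q = 0" "p - q = 0" for p q :: 'f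
    proof -
      have "2 * p = (p + q) + (p - q)" by simp
      then have "p = 0" unfolding that by simp
      with that show ?thesis by simp
    qed
    have ax: "v $ Axis6 0 = 0 \<and> v $ Axis6 3 = 0" "v $ Axis6 2 = 0 \<and> v $ Axis6 5 = 0"
      "v $ Axis6 4 = 0 \<and> v $ Axis6 1 = 0"
      by (rule half; rule zero)+
    then have "v $ Rho6 = 0" using r by simp
    with ax zero(4) have "\<forall>b\<in>{Rho6, U6, Axis6 0, Axis6 1, Axis6 2, Axis6 3, Axis6 4, Axis6 5}. v $ b = 0"
      by simp
    then show "v = 0" unfolding UNIV_basis_6A[symmetric] by (simp add: vec_eq_iff)
  qed
  then show ?thesis by (simp add: g.inj_iff_eq_0)
qed

lemma is_6A:
  assumes generated: "generated_subalgebra {a, x 0, x 1} = UNIV"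
  shows "iso_6A"
proof -
  interpret g: Vector_Spaces.linear "(*s)" scale "combination basis_image" by (rule linear_combination)
  let ?g = "combination basis_image"
  note hom = combination_table_mult[of basis_image table_6A, OF basis_image_table]
  have "subalgebra (range ?g)"
    unfolding subalgebra_def subspace_def
  proof (intro conjI ballI allI)
    show "0 \<in> range ?g" using g.zero by (metis rangeI)
    show "v + w \<in> range ?g" if "v \<in> range ?g" "w \<in> range ?g" for v w
      using that by (auto simp flip: g.add)
    show "scale r v \<in> range ?g" if "v \<in> range ?g" for r v
      using that by (auto simp flip: g.scale)
    show "mult v w \<in> range ?g" if "v \<in> range ?g" "w \<in> range ?g" for v w
      using that by (auto simp flip: hom)
  qed
  moreover have "basis_image b \<in> range ?g" for b
    using combination_basis by (metis rangeI)
  from this[of Rho6] this[of "Axis6 0"] this[of "Axis6 2"] have "{a, x 0, x 1} \<subseteq> range ?g"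
    by (simp add: basis_image_simps x_eq[symmetric])
  ultimately have "range ?g = UNIV" using generated_subalgebra_minimal generated by blast
  with combination_basis_image_injective have bij: "bij ?g" by (simp add: bij_def)
  let ?f = "inv ?g"
  have fg: "?f (?g v) = v" and gf: "?g (?f w) = w" for v w
    using bij by (simp_all add: bij_is_inj bij_is_surj surj_f_inv_f)
  have "algebra_iso scale mult UNIV (*s) (table_mult table_6A) UNIV ?f"
    unfolding algebra_iso_def
  proof (intro conjI ballI allI)
    show "bij ?f" using bij by (rule bij_imp_bij_inv)
    show "?f (v + w) = ?f v + ?f w" for v w using g.add[of "?f v" "?f w"] by (metis fg gf)
    show "?f (scale r v) = r *s ?f v" for r v using g.scale[of r "?f v"] by (metis fg gf)
    show "?f (mult v w) = table_mult table_6A (?f v) (?f w)" for v w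
      using hom[of "?f v" "?f w"] by (metis fg gf)
  qed
  then show ?thesis unfolding iso_6A_def algebra_isomorphic_def by blast
qed

end

section \<open>The three-generated algebras\<close>

lemma (in comm_algebra) type_3A_gives_6A:
  assumes axes: "monster_axis r" "monster_axis p" "monster_axis q"
    and even: "\<And>v. v \<in> even_part r"
    and fixed: "miyamoto p r = r" "miyamoto q r = r"
    and type: "has_type r p D2A"
    and type_pq: "has_type p q D3A"
    and generated: "generated_subalgebra {r, p, q} = UNIV"
  shows "iso_6A"
proof -
  have iso: "dihedral_iso table_3A (\<lambda>n. Some (of_nat n)) p q" using type_pq by simp
  obtain g :: "'f ^ 3 option \<Rightarrow> 'v" where
    g: "Vector_Spaces.linear (*s) scale g"
      "\<And>i j. mult (g (basis_vec i)) (g (basis_vec j)) = g (table_3A i j)"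
      "\<And>k. ((miyamoto q \<circ> miyamoto p) ^^ k) p = g (basis_vec (Some (of_nat (2 * k))))"
      "\<And>k. ((miyamoto q \<circ> miyamoto p) ^^ k) q = g (basis_vec (Some (of_nat (1 + 2 * k))))"
    by (rule dihedral_model[OF iso axes(2,3)]) (rule that, assumption+)
  interpret g: Vector_Spaces.linear "(*s)" scale g by (rule g)
  define x where "x = (\<lambda>i. g (basis_vec (Some i)))"
  interpret orbit_2A scale mult r x "miyamoto q \<circ> miyamoto p"
    by (rule orbit_2A_intro[OF axes even fixed type _ two_generates_3]) (simp add: x_def g(3))
  interpret orbit_3A scale mult r x "miyamoto q \<circ> miyamoto p" "g (basis_vec None)"
    by unfold_locales (simp_all add: x_def g(2) next_3A_def axis_u_3A_def g.add g.diff g.scale)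
  have "p = x 0" "q = x 1" using g(3)[of 0] g(4)[of 0] by (simp_all add: x_def)
  then show ?thesis using is_6A generated by simp
qed

theorem proposition5p2:
  fixes scale :: "'f::field_char_0 \<Rightarrow> 'v::ab_group_add \<Rightarrow> 'v"
    and mult :: "'v \<Rightarrow> 'v \<Rightarrow> 'v"
    and a b c :: 'v
    and L L' M :: dihedral_type
  assumes "monster_axial_algebra scale mult {a, b, c}"
    and "L \<in> {D2A, D2B}" and "L' \<in> {D2A, D2B}" and "M \<in> {D3A, D3C, D5A}"
    and "comm_algebra.has_type scale mult a b L"
    and "comm_algebra.has_type scale mult a c L'"
    and "comm_algebra.has_type scale mult b c M"
  shows "L = L' \<and>
    (comm_algebra.has_type scale mult a b D2A \<and> comm_algebra.has_type scale mult a c D2A \<longrightarrow>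
       comm_algebra.has_type scale mult b c D3A \<and> comm_algebra.iso_6A scale mult) \<and>
    (comm_algebra.has_type scale mult a b D2B \<and> comm_algebra.has_type scale mult a c D2B \<longrightarrow>
       algebra_isomorphic scale mult UNIV (dsum_scale scale) (dsum_mult mult)
         (comm_algebra.generated_subalgebra scale mult {a} \<times>
          comm_algebra.generated_subalgebra scale mult {b, c}))"
proof -
  interpret monster_axial_algebra scale mult "{a, b, c}" by (rule assms(1))
  have axes: "monster_axis a" "monster_axis b" "monster_axis c" using axes by simp_all
  note ab = two_generated_fixed[OF assms(5,2) axes(1,2)]
  note ac = two_generated_fixed[OF assms(6,3) axes(1,3)]
  have aa: "miyamoto a a = a" by (rule miyamoto_fixes_even_part[OF axes(1) axis_in_even_part[OF axes(1)]])
  \<comment> \<open>\<open>\<tau>\<^sub>a\<close> fixes the three generators.\<close>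
  have "miyamoto a v = v" for v
    by (rule automorphism_id[OF generated automorphism_miyamoto(1)[OF axes(1)]]) (auto simp: ab ac aa)
  then have even: "v \<in> even_part a" for v by (rule no_odd_part_if_trivial_miyamoto[OF axes(1)])
  obtain k where k: "((miyamoto c \<circ> miyamoto b) ^^ k) b = c"
    by (rule odd_dihedral_conjugate[OF assms(7,4) axes(2,3)])
  let ?\<phi> = "(miyamoto c \<circ> miyamoto b) ^^ k"
  have aut: "automorphism ?\<phi>"
    by (intro automorphism_funpow automorphism_comp automorphism_miyamoto axes)
  \<comment> \<open>\<open>?\<phi>\<close> fixes \<open>a\<close> and moves \<open>b\<close> to \<open>c\<close>, so it carries \<open>a b\<close> to \<open>a c\<close>.\<close>
  have "?\<phi> a = a" by (induction k) (simp_all add: ab ac)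
  then have "mult a c = ?\<phi> (mult a b)" using k by (simp add: automorphism_simps(3)[OF aut])
  then have zero_iff: "mult a c = 0 \<longleftrightarrow> mult a b = 0"
    using automorphism_simps(5,6)[OF aut] by metis
  \<comment> \<open>Vanishing of the product tells 2B from 2A.\<close>
  have type_ab: "L = D2B \<longleftrightarrow> mult a b = 0"
  proof (cases "L = D2B")
    case True
    then show ?thesis using product_2B[OF _ axes(1,2)] assms(5) by simp
  next
    case False
    then have "has_type a b D2A" using assms(2,5) by auto
    then have "mult a b \<noteq> 0" by (rule product_2A[OF _ axes(1,2)])
    with False show ?thesis by simp
  qed
  have type_ac: "L' = D2B \<longleftrightarrow> mult a c = 0"
  proof (cases "L' = D2B")
    case True
    then show ?thesis using product_2B[OF _ axes(1,3)] assms(6) by simp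
  next
    case False
    then have "has_type a c D2A" using assms(3,6) by auto
    then have "mult a c \<noteq> 0" by (rule product_2A[OF _ axes(1,3)])
    with False show ?thesis by simp
  qed
  show ?thesis
  proof (intro conjI impI)
    show "L = L'" using type_ab type_ac zero_iff assms(2,3) by auto
  next
    assume 2: "has_type a b D2A \<and> has_type a c D2A"
    then have ab2A: "has_type a b D2A" by simp
    note setting = axes even ab(2) ac(2) ab2A
    have "M = D3A"
      using assms(4,7) not_3C[OF setting] not_5A[OF setting] by auto
    then show b3A: "has_type b c D3A" using assms(7) by simp
    show "iso_6A" by (rule type_3A_gives_6A[OF setting b3A generated])
  next
    assume "has_type a b D2B \<and> has_type a c D2B"
    then have "mult a b = 0" "mult a c = 0"
      using product_2B[OF _ axes(1,2)] product_2B[OF _ axes(1,3)] by auto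
    then show "algebra_isomorphic scale mult UNIV (dsum_scale scale) (dsum_mult mult)
        (generated_subalgebra {a} \<times> generated_subalgebra {b, c})"
      by (intro annihilated_generators_direct_sum axes(1) generated) auto
  qed
qed

end
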